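(* Let $X$ be any (real or complex) Banach space and let $T$ be any invertible operator on $X$. Then the following assertions are equivalent: (i) $T$ is hyperbolic; (ii) $T$ has hyperbolic coordinates; (iii) $T$ is expansive and has the shadowing property.
   Context: An operator on a Banach space $X$ is a bounded linear map $T:X\to X$; it is invertible if it is bijective (so $T^{-1}$ is bounded). $S_X$ is the unit sphere of $X$, $\mathbb{N}$ is the set of positive integers, and $\mathbb{T}$ is the unit circle in $\mathbb{C}$. Hyperbolic: if $X$ is complex, $T$ is hyperbolic if its spectrum satisfies $\sigma(T)\cap\mathbb{T}=\emptyset$; if $X$ is real, $T$ is hyperbolic if $\sigma(T_{\mathbb{C}})\cap\mathbb{T}=\emptyset$, where $T_{\mathbb{C}}$ is the complexification of $T$. Expansive: the invertible operator $T$ is expansive if there is a constant $c>1$ such that for each $x\in S_X$ there exists $n\in\mathbb{Z}$ with $\|T^nx\|\ge c$ (equivalently, there is $e>0$ such that for all distinct $x,y\in X$ there is $n\in\mathbb{Z}$ with $\|T^nx-T^ny\|\ge e$). Shadowing property: for $\delta>0$, a sequence $(x_n)_{n\in\mathbb{Z}}$ in $X$ is a $\delta$-pseudotrajectory of $T$ if $\|Tx_n-x_{n+1}\|\le\delta$ for all $n\in\mathbb{Z}$. $T$ has the shadowing property if for every $\varepsilon>0$ there exists $\delta>0$ such that for every $\delta$-pseudotrajectory $(x_n)_{n\in\mathbb{Z}}$ of $T$ there is $x\in X$ with $\|x_n-T^nx\|<\varepsilon$ for all $n\in\mathbb{Z}$. Hyperbolic coordinates: for a homeomorphism $h:M\to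 M$ of a metric space $(M,d)$, $x\in M$ and $\varepsilon>0$, put $W^s_\varepsilon(x,h)=\{y\in M: d(h^n(x),h^n(y))\le\varepsilon \text{ for all } n\ge 0\}$ and $W^u_\varepsilon(x,h)=\{y\in M: d(h^{-n}(x),h^{-n}(y))\le\varepsilon \text{ for all } n\ge 0\}$. $h$ has canonical coordinates if for each $\varepsilon>0$ there exists $\delta>0$ such that $d(x,y)\le\delta$ implies $W^s_\varepsilon(x,h)\cap W^u_\varepsilon(y,h)\ne\emptyset$. $h$ has hyperbolic coordinates if it has canonical coordinates and there exist constants $c\ge 1$, $0<\beta<1$ and $\gamma>0$ such that for each $x\in M$: $y\in W^s_\gamma(x,h)$ implies $d(h^n(x),h^n(y))\le c\beta^n d(x,y)$ for all $n\in\mathbb{N}$, and $y\in W^u_\gamma(x,h)$ implies $d(h^{-n}(x),h^{-n}(y))\le c\beta^n d(x,y)$ for all $n\in\mathbb{N}$. These notions are applied to $h=T$ on $M=X$ with the norm metric. *)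

theory Defs
  imports "HOL-Analysis.Analysis"
begin

class complex_normed_vector = real_normed_vector +
  fixes scaleC :: "complex \<Rightarrow> 'a \<Rightarrow> 'a" (infixr \<open>*\<^sub>C\<close> 75)
  assumes scaleC_of_real: "complex_of_real r *\<^sub>C x = r *\<^sub>R x"
    and scaleC_add_right: "a *\<^sub>C (x + y) = a *\<^sub>C x + a *\<^sub>C y"
    and scaleC_add_left: "(a + b) *\<^sub>C x = a *\<^sub>C x + b *\<^sub>C x"
    and scaleC_scaleC: "a *\<^sub>C b *\<^sub>C x = (a * b) *\<^sub>C x"
    and norm_scaleC: "norm (a *\<^sub>C x) = cmod a * norm x"

class complex_banach = complex_normed_vector + banach

definition bounded_clinear ::
  "('a::complex_normed_vector \<Rightarrow> 'b::complex_normed_vector) \<Rightarrow> bool" where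
  "bounded_clinear f \<longleftrightarrow> bounded_linear f \<and> (\<forall>a x. f (a *\<^sub>C x) = a *\<^sub>C f x)"

text \<open>The element \<open>Cplx x y\<close> stands for $x + iy$.\<close>

datatype 'a complexification = Cplx (re_part: 'a) (im_part: 'a)

text \<open>The norm is the Taylor norm
  $\|x + iy\| = \sup_t \|\cos(t)\,x - \sin(t)\,y\|$, the supremum of the norms of the real
  parts of $e^{it}(x+iy)$. Invertibility of an operator, hence the spectrum, is the same for
  every equivalent norm.\<close>

instantiation complexification :: (real_normed_vector) complex_normed_vector
begin

definition zero_complexification :: "'a complexification" where
  "0 = Cplx 0 0"

definition plus_complexification ::
  "'a complexification \<Rightarrow> 'a complexification \<Rightarrow> 'a complexification" where
  "z + w = Cplx (re_part z + re_part w) (im_part z + im_part w)"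

definition minus_complexification ::
  "'a complexification \<Rightarrow> 'a complexification \<Rightarrow> 'a complexification" where
  "z - w = Cplx (re_part z - re_part w) (im_part z - im_part w)"

definition uminus_complexification :: "'a complexification \<Rightarrow> 'a complexification" where
  "- z = Cplx (- re_part z) (- im_part z)"

definition scaleR_complexification ::
  "real \<Rightarrow> 'a complexification \<Rightarrow> 'a complexification" where
  "r *\<^sub>R z = Cplx (r *\<^sub>R re_part z) (r *\<^sub>R im_part z)"

definition scaleC_complexification ::
  "complex \<Rightarrow> 'a complexification \<Rightarrow> 'a complexification" where
  "a *\<^sub>C z = Cplx (Re a *\<^sub>R re_part z - Im a *\<^sub>R im_part z)
                (Re a *\<^sub>R im_part z + Im a *\<^sub>R re_part z)"

definition norm_complexification :: "'a complexification \<Rightarrow> real" where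
  "norm z = (SUP t::real. norm (cos t *\<^sub>R re_part z - sin t *\<^sub>R im_part z))"

definition dist_complexification ::
  "'a complexification \<Rightarrow> 'a complexification \<Rightarrow> real" where
  "dist_complexification z w = norm (z - w)"

definition sgn_complexification :: "'a complexification \<Rightarrow> 'a complexification" where
  "sgn_complexification z = inverse (norm z) *\<^sub>R z"

definition uniformity_complexification ::
  "('a complexification \<times> 'a complexification) filter" where
  "uniformity_complexification = (INF e\<in>{0 <..}. principal {(x, y). dist x y < e})"

definition open_complexification :: "'a complexification set \<Rightarrow> bool" where
  "open_complexification U =
    (\<forall>x\<in>U. eventually (\<lambda>(x', y). x' = x \<longrightarrow> y \<in> U) uniformity)"

lemma part_le_sum:
  "norm (cos t *\<^sub>R x - sin t *\<^sub>R y) \<le> norm x + norm (y::'a)"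
proof -
  have "norm (cos t *\<^sub>R x - sin t *\<^sub>R y) \<le> \<bar>cos t\<bar> * norm x + \<bar>sin t\<bar> * norm y"
    using norm_triangle_ineq4[of "cos t *\<^sub>R x" "sin t *\<^sub>R y"] by simp
  also have "\<dots> \<le> 1 * norm x + 1 * norm y"
    by (intro add_mono mult_right_mono) auto
  finally show ?thesis by simp
qed

lemma part_le_norm:
  "norm (cos t *\<^sub>R re_part z - sin t *\<^sub>R im_part z) \<le> norm (z::'a complexification)"
  unfolding norm_complexification_def
  by (rule cSUP_upper) (auto intro!: bdd_aboveI2 part_le_sum)

lemma norm_complexification_leI:
  "(\<And>t. norm (cos t *\<^sub>R re_part z - sin t *\<^sub>R im_part z) \<le> K)
    \<Longrightarrow> norm (z::'a complexification) \<le> K"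
  unfolding norm_complexification_def by (rule cSUP_least) auto

lemma norm_re_part_le: "norm (re_part z) \<le> norm (z::'a complexification)"
  using part_le_norm[of 0 z] by simp

lemma norm_im_part_le: "norm (im_part z) \<le> norm (z::'a complexification)"
  using part_le_norm[of "pi/2" z] by simp

lemma norm_complexification_le_sum:
  "norm (z::'a complexification) \<le> norm (re_part z) + norm (im_part z)"
  by (rule norm_complexification_leI) (rule part_le_sum)

lemma scaleC_norm_le: "norm (a *\<^sub>C z) \<le> cmod a * norm (z::'a complexification)"
proof (rule norm_complexification_leI)
  fix t
  define s where "s = t + Arg a"
  have a: "Re a = cmod a * cos (Arg a)" "Im a = cmod a * sin (Arg a)"
    using rcis_cmod_Arg[of a] by (metis Re_rcis, metis Im_rcis rcis_cmod_Arg)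
  have "cos t *\<^sub>R re_part (a *\<^sub>C z) - sin t *\<^sub>R im_part (a *\<^sub>C z) =
      (cos t * Re a - sin t * Im a) *\<^sub>R re_part z - (cos t * Im a + sin t * Re a) *\<^sub>R im_part z"
    by (simp add: scaleC_complexification_def algebra_simps)
  also have "cos t * Re a - sin t * Im a = cmod a * cos s"
    unfolding a s_def cos_add by (simp add: algebra_simps)
  also have "cos t * Im a + sin t * Re a = cmod a * sin s"
    unfolding a s_def sin_add by (simp add: algebra_simps)
  finally have "cos t *\<^sub>R re_part (a *\<^sub>C z) - sin t *\<^sub>R im_part (a *\<^sub>C z) =
      cmod a *\<^sub>R (cos s *\<^sub>R re_part z - sin s *\<^sub>R im_part z)"
    by (simp add: algebra_simps)
  then show "norm (cos t *\<^sub>R re_part (a *\<^sub>C z) - sin t *\<^sub>R im_part (a *\<^sub>C z))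
      \<le> cmod a * norm z"
    by (simp add: mult_left_mono part_le_norm)
qed

instance
proof
  fix x y z :: "'a complexification" and a b :: complex and r q :: real
    and U :: "'a complexification set"
  show scC: "complex_of_real r *\<^sub>C x = r *\<^sub>R x" for r and x :: "'a complexification"
    by (simp add: scaleC_complexification_def scaleR_complexification_def)
  have CC: "a *\<^sub>C b *\<^sub>C x = (a * b) *\<^sub>C x" for a b and x :: "'a complexification"
    by (simp add: scaleC_complexification_def algebra_simps)
  then show "a *\<^sub>C b *\<^sub>C x = (a * b) *\<^sub>C x" .
  show nC: "norm (a *\<^sub>C x) = cmod a * norm x" for a and x :: "'a complexification"
  proof (cases "a = 0")
    case True
    then show ?thesis
      by (simp add: scaleC_complexification_def norm_complexification_def)
  next
    case False
    have "x = inverse a *\<^sub>C a *\<^sub>C x"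
      unfolding CC using False by (simp add: scaleC_complexification_def)
    then have "norm x \<le> cmod (inverse a) * norm (a *\<^sub>C x)"
      using scaleC_norm_le[of "inverse a" "a *\<^sub>C x"] by simp
    then have "cmod a * norm x \<le> norm (a *\<^sub>C x)"
      using False by (simp only: norm_inverse) (simp add: field_simps)
    with scaleC_norm_le[of a x] show ?thesis by simp
  qed
  show "norm (r *\<^sub>R x) = \<bar>r\<bar> * norm x"
    unfolding scC[symmetric] nC by simp
  show "norm (x + y) \<le> norm x + norm y"
  proof (rule norm_complexification_leI)
    fix t
    have "cos t *\<^sub>R re_part (x + y) - sin t *\<^sub>R im_part (x + y) =
        (cos t *\<^sub>R re_part x - sin t *\<^sub>R im_part x) + (cos t *\<^sub>R re_part y - sin t *\<^sub>R im_part y)"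
      by (simp add: plus_complexification_def algebra_simps)
    then show "norm (cos t *\<^sub>R re_part (x + y) - sin t *\<^sub>R im_part (x + y)) \<le> norm x + norm y"
      using norm_triangle_mono[OF part_le_norm part_le_norm] by metis
  qed
  show "norm x = 0 \<longleftrightarrow> x = 0"
  proof
    assume "norm x = 0"
    then show "x = 0"
      using norm_re_part_le[of x] norm_im_part_le[of x]
      by (cases x) (simp add: zero_complexification_def)
  next
    assume "x = 0"
    then show "norm x = 0"
      by (simp add: zero_complexification_def norm_complexification_def)
  qed
  show "dist x y = norm (x - y)" by (fact dist_complexification_def)
  show "sgn x = inverse (norm x) *\<^sub>R x" by (simp add: sgn_complexification_def)
  show "(uniformity :: ('a complexification \<times> 'a complexification) filter) =
      (INF e\<in>{0 <..}. principal {(x, y). dist x y < e})"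
    by (fact uniformity_complexification_def)
  show "open U = (\<forall>x\<in>U. \<forall>\<^sub>F (x', y) in uniformity. x' = x \<longrightarrow> y \<in> U)"
    by (fact open_complexification_def)
qed (auto simp: zero_complexification_def plus_complexification_def minus_complexification_def
    uminus_complexification_def scaleR_complexification_def scaleC_complexification_def
    algebra_simps)

end

instance complexification :: (banach) complex_banach
proof
  fix X :: "nat \<Rightarrow> 'a complexification"
  assume X: "Cauchy X"
  have part: "Cauchy (\<lambda>n. re_part (X n))" "Cauchy (\<lambda>n. im_part (X n))"
  proof -
    have *: "dist (re_part (X m)) (re_part (X n)) \<le> dist (X m) (X n)"
      "dist (im_part (X m)) (im_part (X n)) \<le> dist (X m) (X n)" for m n
      using norm_re_part_le[of "X m - X n"] norm_im_part_le[of "X m - X n"]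
      by (simp_all add: dist_norm minus_complexification_def)
    show "Cauchy (\<lambda>n. re_part (X n))" "Cauchy (\<lambda>n. im_part (X n))"
      using X * unfolding Cauchy_def by (meson le_less_trans)+
  qed
  then obtain x y where xy: "(\<lambda>n. re_part (X n)) \<longlonglongrightarrow> x" "(\<lambda>n. im_part (X n)) \<longlonglongrightarrow> y"
    using Cauchy_convergent unfolding convergent_def by metis
  have "(\<lambda>n. norm (re_part (X n) - x) + norm (im_part (X n) - y)) \<longlonglongrightarrow> 0"
    using tendsto_add[OF xy[THEN LIM_zero, THEN tendsto_norm_zero]] by simp
  then have "(\<lambda>n. X n - Cplx x y) \<longlonglongrightarrow> 0"
  proof (rule Lim_null_comparison[rotated])
    show "\<forall>\<^sub>F n in sequentially. norm (X n - Cplx x y)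
        \<le> norm (re_part (X n) - x) + norm (im_part (X n) - y)"
      using norm_complexification_le_sum[of "X n - Cplx x y" for n]
      by (simp add: minus_complexification_def)
  qed
  then show "convergent X"
    unfolding convergent_def using LIM_zero_cancel by blast
qed

definition complexify :: "('a \<Rightarrow> 'a) \<Rightarrow> 'a complexification \<Rightarrow> 'a complexification" where
  "complexify T z = Cplx (T (re_part z)) (T (im_part z))"

lemma bounded_clinear_complexify:
  fixes T :: "'a::real_normed_vector \<Rightarrow> 'a"
  assumes "bounded_linear T"
  shows "bounded_clinear (complexify T)"
proof -
  interpret bounded_linear T by fact
  obtain K where K: "K \<ge> 0" "\<And>x. norm (T x) \<le> norm x * K" using nonneg_bounded by blast
  have "norm (complexify T z) \<le> norm z * (2 * K)" for z :: "'a complexification"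
  proof -
    have "norm (complexify T z) \<le> norm (T (re_part z)) + norm (T (im_part z))"
      using norm_complexification_le_sum[of "complexify T z"] by (simp add: complexify_def)
    also have "\<dots> \<le> norm z * K + norm z * K"
      by (intro add_mono order_trans[OF K(2)] mult_right_mono norm_re_part_le
          norm_im_part_le K(1))
    finally show ?thesis by (simp add: mult.left_commute mult.commute)
  qed
  then have "bounded_linear (complexify T)"
    by (intro bounded_linear_intro[where K = "2 * K"])
      (simp_all add: complexify_def plus_complexification_def scaleR_complexification_def add scale)
  then show ?thesis
    by (simp add: bounded_clinear_def complexify_def scaleC_complexification_def
        add diff scale)
qed

definition spectrum :: "('a::complex_banach \<Rightarrow> 'a) \<Rightarrow> complex set" where
  "spectrum T = {l. \<not> bij (\<lambda>x. T x - l *\<^sub>C x)}"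

definition complex_hyperbolic :: "('a::complex_banach \<Rightarrow> 'a) \<Rightarrow> bool" where
  "complex_hyperbolic T \<longleftrightarrow> spectrum T \<inter> sphere 0 1 = {}"

definition real_hyperbolic :: "('a::banach \<Rightarrow> 'a) \<Rightarrow> bool" where
  "real_hyperbolic T \<longleftrightarrow> spectrum (complexify T) \<inter> sphere 0 1 = {}"

text \<open>For bijective \<open>T\<close>, \<open>zpow T n\<close> is $T^n$ with \<open>n\<close> an integer.\<close>

definition zpow :: "('a \<Rightarrow> 'a) \<Rightarrow> int \<Rightarrow> 'a \<Rightarrow> 'a" where
  "zpow T n = (if n \<ge> 0 then T ^^ nat n else inv T ^^ nat (- n))"

definition expansive :: "('a::real_normed_vector \<Rightarrow> 'a) \<Rightarrow> bool" where
  "expansive T \<longleftrightarrow> (\<exists>c>1. \<forall>x\<in>sphere 0 1. \<exists>n::int. norm (zpow T n x) \<ge> c)"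

definition pseudotrajectory ::
  "real \<Rightarrow> ('a::real_normed_vector \<Rightarrow> 'a) \<Rightarrow> (int \<Rightarrow> 'a) \<Rightarrow> bool" where
  "pseudotrajectory \<delta> T x \<longleftrightarrow> (\<forall>n. norm (T (x n) - x (n + 1)) \<le> \<delta>)"

definition shadowing_property :: "('a::real_normed_vector \<Rightarrow> 'a) \<Rightarrow> bool" where
  "shadowing_property T \<longleftrightarrow>
    (\<forall>\<epsilon>>0. \<exists>\<delta>>0. \<forall>x. pseudotrajectory \<delta> T x \<longrightarrow>
      (\<exists>y. \<forall>n. norm (x n - zpow T n y) < \<epsilon>))"

text \<open>In the definitions below, \<open>h\<close> is meant to be a homeomorphism.\<close>

definition stable_set :: "real \<Rightarrow> 'a \<Rightarrow> ('a::metric_space \<Rightarrow> 'a) \<Rightarrow> 'a set" where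
  "stable_set \<epsilon> x h = {y. \<forall>n::nat. dist ((h ^^ n) x) ((h ^^ n) y) \<le> \<epsilon>}"

definition unstable_set :: "real \<Rightarrow> 'a \<Rightarrow> ('a::metric_space \<Rightarrow> 'a) \<Rightarrow> 'a set" where
  "unstable_set \<epsilon> x h = {y. \<forall>n::nat. dist ((inv h ^^ n) x) ((inv h ^^ n) y) \<le> \<epsilon>}"

definition canonical_coordinates :: "('a::metric_space \<Rightarrow> 'a) \<Rightarrow> bool" where
  "canonical_coordinates h \<longleftrightarrow>
    (\<forall>\<epsilon>>0. \<exists>\<delta>>0. \<forall>x y. dist x y \<le> \<delta> \<longrightarrow> stable_set \<epsilon> x h \<inter> unstable_set \<epsilon> y h \<noteq> {})"

definition hyperbolic_coordinates :: "('a::metric_space \<Rightarrow> 'a) \<Rightarrow> bool" where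
  "hyperbolic_coordinates h \<longleftrightarrow> canonical_coordinates h \<and>
    (\<exists>c \<beta> \<gamma>. c \<ge> 1 \<and> 0 < \<beta> \<and> \<beta> < 1 \<and> \<gamma> > 0 \<and>
      (\<forall>x.
        (\<forall>y\<in>stable_set \<gamma> x h. \<forall>n\<ge>1. dist ((h ^^ n) x) ((h ^^ n) y) \<le> c * \<beta> ^ n * dist x y) \<and>
        (\<forall>y\<in>unstable_set \<gamma> x h. \<forall>n\<ge>1.
          dist ((inv h ^^ n) x) ((inv h ^^ n) y) \<le> c * \<beta> ^ n * dist x y)))"

end

theory Submission
  imports Defs
begin

text \<open>All three properties are equivalent to the existence of an exponential dichotomy
  \<open>x = P x + (x - P x)\<close>, with \<open>P\<close> commuting with \<open>T\<close>, \<open>T\<^sup>n\<close> contracting exponentially on the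
  range of \<open>P\<close> and the powers of the inverse on the complementary part.

  Hyperbolic coordinates at 0 split every vector into a vector with bounded forward orbit and one
  with bounded backward orbit, and the rates are the dichotomy. Conversely a dichotomy solves
  \<open>x (n + 1) = T (x n) + f n\<close> in bounded sequences by a Green's function, which gives shadowing.
  Expansivity makes bounded solutions unique, and for \<open>f n = l\<^sup>n y\<close> with \<open>|l| = 1\<close>
  uniqueness forces \<open>x n = l\<^sup>n x 0\<close>, so \<open>T - l\<close> is bijective.

  From hyperbolicity, \<open>P\<close> is the mean of \<open>(1 - r u T)\<^bsup>-1\<^esup>\<close> over \<open>|u| = 1\<close>, a Riesz projection.
  The mean is the limit of averages over roots of unity and does not depend on \<open>r\<close> near 1. Taking
  \<open>r > 1\<close> gives the decay of \<open>T\<^sup>n P\<close>, and \<open>r < 1\<close> that of the inverse powers on \<open>1 - P\<close>.\<close>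

section \<open>Exponential dichotomies\<close>

text \<open>\<open>P\<close> may be any map, so that it can come from choosing a splitting of each
  vector or from taking real parts. The rates at n = 0 make both parts bounded.\<close>

definition exponential_dichotomy :: "('a::real_normed_vector \<Rightarrow> 'a) \<Rightarrow> bool" where
  "exponential_dichotomy T \<longleftrightarrow>
    (\<exists>P M \<beta>. 0 < M \<and> 0 < \<beta> \<and> \<beta> < 1 \<and> (\<forall>x. P (T x) = T (P x)) \<and>
      (\<forall>x n. norm ((T ^^ n) (P x)) \<le> M * \<beta> ^ n * norm x) \<and>
      (\<forall>x n. norm ((inv T ^^ n) (x - P x)) \<le> M * \<beta> ^ n * norm x))"

section \<open>Powers of linear bijections, indexed by integers\<close>

lemma linear_inv_bij:
  fixes T :: "'a::real_vector \<Rightarrow> 'a"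
  assumes "linear T" "bij T"
  shows "linear (inv T)"
proof -
  have inv: "inv T (T x) = x" "T (inv T x) = x" for x
    using assms(2) by (simp_all add: bij_is_inj bij_is_surj surj_f_inv_f)
  show ?thesis
  proof (rule linearI)
    show "inv T (x + y) = inv T x + inv T y" for x y
      by (metis inv linear_add[OF assms(1)])
    show "inv T (r *\<^sub>R x) = r *\<^sub>R inv T x" for r x
      by (metis inv linear_scale[OF assms(1)])
  qed
qed

lemma linear_funpow:
  fixes T :: "'a::real_vector \<Rightarrow> 'a"
  assumes "linear T"
  shows "linear (T ^^ n)"
proof (induction n)
  case (Suc n)
  then show ?case
    using linear_compose[OF Suc assms] by (simp only: funpow.simps)
qed (simp add: linear_id[unfolded id_def] id_def)

lemma bounded_linear_funpow:
  fixes T :: "'a::real_normed_vector \<Rightarrow> 'a"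
  assumes "bounded_linear T"
  shows "bounded_linear (T ^^ n)"
proof (induction n)
  case (Suc n)
  then show ?case
    using bounded_linear_compose[OF assms Suc] by (simp add: o_def)
qed (simp add: id_def)

lemma inv_funpow_cancel:
  fixes T :: "'a \<Rightarrow> 'a"
  assumes "bij T"
  shows "(inv T ^^ n) ((T ^^ n) x) = x" "(T ^^ n) ((inv T ^^ n) x) = x"
proof -
  have *: "inv T (T x) = x" "T (inv T x) = x" for x
    using assms by (simp_all add: bij_is_inj bij_is_surj surj_f_inv_f)
  show "(inv T ^^ n) ((T ^^ n) x) = x" 
    by (induction n arbitrary: x) (simp_all add: * funpow_swap1)
  show "(T ^^ n) ((inv T ^^ n) x) = x" 
    by (induction n arbitrary: x) (simp_all add: * funpow_swap1)
qed

lemma zpow_zero [simp]: "zpow T 0 x = x"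
  by (simp add: zpow_def)

lemma zpow_of_nat: "zpow T (int n) = T ^^ n"
  by (simp add: zpow_def)

lemma zpow_minus_of_nat: "zpow T (- int n) = inv T ^^ n"
  by (cases "n = 0") (auto simp: zpow_def fun_eq_iff)

lemma zpow_Suc:
  assumes "bij T"
  shows "zpow T (n + 1) x = T (zpow T n x)"
proof -
  have *: "T (inv T x) = x" for x
    using assms by (simp add: bij_is_surj surj_f_inv_f)
  show ?thesis
  proof (cases n rule: int_cases2)
    case (nonneg m)
    then have "n + 1 = int (Suc m)" by simp
    then show ?thesis using nonneg by (simp only: zpow_of_nat) simp
  next
    case (nonpos m)
    show ?thesis
    proof (cases m)
      case 0
      then show ?thesis using nonpos by (simp add: zpow_def)
    next
      case (Suc l)
      then have "n + 1 = - int l" using nonpos by simp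
      then show ?thesis using nonpos Suc by (simp only: zpow_minus_of_nat) (simp add: *)
    qed
  qed
qed

lemma zpow_eqI:
  assumes "bij T" and orbit: "\<And>n. u (n + 1) = T (u n)"
  shows "u n = zpow T n (u 0)"
proof (induction n rule: int_induct[where k=0])
  case base
  show ?case by simp
next
  case (step1 i)
  then show ?case using zpow_Suc[OF assms(1)] orbit by simp
next
  case (step2 i)
  have "T (u (i - 1)) = T (zpow T (i - 1) (u 0))"
    using step2 orbit[of "i - 1"] zpow_Suc[OF assms(1), of "i - 1" "u 0"] by simp
  then show ?case using assms(1) by (metis bij_is_inj injD)
qed

lemma zpow_scaleR:
  fixes T :: "'a::real_vector \<Rightarrow> 'a"
  assumes "linear T" "bij T"
  shows "zpow T n (r *\<^sub>R x) = r *\<^sub>R zpow T n x"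
  unfolding zpow_def
  using linear_funpow[OF assms(1)] linear_funpow[OF linear_inv_bij[OF assms]]
  by (simp add: linear_scale)

lemma le_mult_powers_imp_zero:
  fixes a C \<beta> :: real
  assumes "0 < \<beta>" "\<beta> < 1" "\<And>n::nat. a \<le> C * \<beta> ^ n"
  shows "a \<le> 0"
proof (rule LIMSEQ_le_const)
  show "(\<lambda>n. C * \<beta> ^ n) \<longlonglongrightarrow> 0"
    using LIMSEQ_power_zero[of \<beta>] assms tendsto_mult_right_zero by auto
qed (use assms(3) in auto)

section \<open>Consequences of a dichotomy: hyperbolic coordinates, expansivity, shadowing\<close>

locale dichotomy =
  fixes T P :: "'a::banach \<Rightarrow> 'a" and M \<beta> :: real
  assumes bl: "bounded_linear T" and bij: "bij T"
    and M: "0 < M" and \<beta>: "0 < \<beta>" "\<beta> < 1"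
    and commute: "\<And>x. P (T x) = T (P x)"
    and stable: "\<And>x n. norm ((T ^^ n) (P x)) \<le> M * \<beta> ^ n * norm x"
    and unstable: "\<And>x n. norm ((inv T ^^ n) (x - P x)) \<le> M * \<beta> ^ n * norm x"
begin

lemma lin: "linear T" "linear (inv T)" "linear (T ^^ n)" "linear (inv T ^^ n)"
  using bl bij linear_inv_bij linear_funpow bounded_linear.linear by blast+

lemma inv_simps [simp]: "inv T (T x) = x" "T (inv T x) = x"
  using bij by (simp_all add: bij_is_inj bij_is_surj surj_f_inv_f)

lemma commute_inv: "P (inv T x) = inv T (P x)"
  by (metis commute inv_simps)

lemma commute_funpow: "P ((T ^^ n) x) = (T ^^ n) (P x)" "P ((inv T ^^ n) x) = (inv T ^^ n) (P x)"
  by (induction n) (simp_all add: commute commute_inv)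

text \<open>\<open>q - P q\<close> is the n-th inverse power of the corresponding part of
  \<open>(T ^^ n) q\<close>, so the unstable rate bounds it by a multiple of
  \<open>\<beta> ^ n\<close> for every n. Time reversal treats \<open>P q\<close> in the same
  way.\<close>

lemma bounded_orbit_zero:
  assumes fwd: "\<And>n. norm ((T ^^ n) q) \<le> B" and bwd: "\<And>n. norm ((inv T ^^ n) q) \<le> B"
  shows "q = 0"
proof -
  have "norm (q - P q) \<le> M * B * \<beta> ^ n" for n
  proof -
    have "q - P q = (inv T ^^ n) ((T ^^ n) q - P ((T ^^ n) q))"
      by (simp add: commute_funpow linear_diff[OF lin(4)] inv_funpow_cancel[OF bij])
    then have "norm (q - P q) \<le> M * \<beta> ^ n * norm ((T ^^ n) q)"
      using unstable by simp
    also have "\<dots> \<le> M * \<beta> ^ n * B"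
      using fwd M \<beta> by (intro mult_left_mono) auto
    finally show ?thesis by (simp add: mult_ac)
  qed
  moreover have "norm (P q) \<le> M * B * \<beta> ^ n" for n
  proof -
    have "P q = (T ^^ n) (P ((inv T ^^ n) q))"
      by (simp add: commute_funpow inv_funpow_cancel[OF bij])
    then have "norm (P q) \<le> M * \<beta> ^ n * norm ((inv T ^^ n) q)"
      using stable by simp
    also have "\<dots> \<le> M * \<beta> ^ n * B"
      using bwd M \<beta> by (intro mult_left_mono) auto
    finally show ?thesis by (simp add: mult_ac)
  qed
  ultimately have "norm (q - P q) \<le> 0" "norm (P q) \<le> 0"
    using le_mult_powers_imp_zero[OF \<beta>] by blast+
  then show ?thesis by simp
qed

lemma power_le_one: "\<beta> ^ n \<le> 1"
  using \<beta> by (simp add: power_le_one)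

lemma stable_bound: "norm ((T ^^ n) (P x)) \<le> M * norm x"
proof -
  have "M * \<beta> ^ n * norm x \<le> M * 1 * norm x"
    using M power_le_one by (intro mult_right_mono mult_left_mono) auto
  then show ?thesis using stable[of n x] by simp
qed

lemma unstable_bound: "norm ((inv T ^^ n) (x - P x)) \<le> M * norm x"
proof -
  have "M * \<beta> ^ n * norm x \<le> M * 1 * norm x"
    using M power_le_one by (intro mult_right_mono mult_left_mono) auto
  then show ?thesis using unstable[of n x] by simp
qed

text \<open>The backward orbit of \<open>v - P v\<close> is bounded by the unstable rate; forward it
  is a difference of two bounded orbits. So its whole orbit is bounded and it vanishes.\<close>

lemma bounded_forward_imp_fixed:
  assumes "\<And>n. norm ((T ^^ n) v) \<le> B"
  shows "P v = v"
proof -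
  have "v - P v = 0"
  proof (rule bounded_orbit_zero)
    fix n
    have B: "0 \<le> B" using assms[of 0] norm_ge_zero order_trans by blast
    have "norm ((T ^^ n) (v - P v)) \<le> norm ((T ^^ n) v) + norm ((T ^^ n) (P v))"
      unfolding linear_diff[OF lin(3)] by (rule norm_triangle_ineq4)
    then show "norm ((T ^^ n) (v - P v)) \<le> B + M * norm v"
      using assms[of n] stable_bound[of n v] by linarith
    show "norm ((inv T ^^ n) (v - P v)) \<le> B + M * norm v"
      using unstable_bound[of n v] B by linarith
  qed
  then show ?thesis by simp
qed

lemma bounded_backward_imp_zero:
  assumes "\<And>n. norm ((inv T ^^ n) v) \<le> B"
  shows "P v = 0"
proof (rule bounded_orbit_zero)
  fix n
  have B: "0 \<le> B" using assms[of 0] norm_ge_zero order_trans by blast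
  have "(inv T ^^ n) (P v) = (inv T ^^ n) v - (inv T ^^ n) (v - P v)"
    by (simp add: linear_diff[OF lin(4)])
  then have "norm ((inv T ^^ n) (P v)) \<le> norm ((inv T ^^ n) v) + norm ((inv T ^^ n) (v - P v))"
    using norm_triangle_ineq4 by metis
  then show "norm ((inv T ^^ n) (P v)) \<le> B + M * norm v"
    using assms[of n] unstable_bound[of n v] by linarith
  show "norm ((T ^^ n) (P v)) \<le> B + M * norm v"
    using stable_bound[of n v] B by linarith
qed

lemma imp_hyperbolic_coordinates: "hyperbolic_coordinates T"
  unfolding hyperbolic_coordinates_def
proof
  show "canonical_coordinates T"
    unfolding canonical_coordinates_def
  proof (intro allI impI exI conjI)
    fix \<epsilon> :: real and x y :: 'a
    assume \<epsilon>: "\<epsilon> > 0"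
    show "\<epsilon> / M > 0" using \<epsilon> M by simp
    assume "dist x y \<le> \<epsilon> / M"
    then have d: "M * norm (y - x) \<le> \<epsilon>"
      using M by (simp add: dist_norm norm_minus_commute field_simps)
    \<comment> \<open>Moving from \<open>x\<close> by the stable part of \<open>y - x\<close> leaves
      exactly the unstable part on the way to \<open>y\<close>, so one point serves both sets, and
      both deviations stay below \<open>M\<close> times the distance.\<close>
    define z where "z = x + P (y - x)"
    have "(T ^^ n) z - (T ^^ n) x = (T ^^ n) (P (y - x))" for n
      by (simp add: z_def linear_add[OF lin(3)])
    then have "z \<in> stable_set \<epsilon> x T"
      using order_trans[OF stable_bound d] by (simp add: stable_set_def dist_norm norm_minus_commute)
    moreover have "(inv T ^^ n) y - (inv T ^^ n) z = (inv T ^^ n) ((y - x) - P (y - x))" for n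
      by (simp add: z_def linear_add[OF lin(4)] linear_diff[OF lin(4)])
    then have "z \<in> unstable_set \<epsilon> y T"
      using order_trans[OF unstable_bound d] by (simp add: unstable_set_def dist_norm)
    ultimately show "stable_set \<epsilon> x T \<inter> unstable_set \<epsilon> y T \<noteq> {}" by blast
  qed
  \<comment> \<open>Any bounded orbit of a difference obeys the rate, so the radius \<gamma> can be
    1; \<open>max 1 M\<close> meets the demand that the constant be at least 1.\<close>
  have s: "dist ((T ^^ n) x) ((T ^^ n) y) \<le> max 1 M * \<beta> ^ n * dist x y"
    if "y \<in> stable_set 1 x T" for x y n
  proof -
    have "P (x - y) = x - y"
      using that
      by (intro bounded_forward_imp_fixed[of _ 1])
        (simp add: stable_set_def dist_norm linear_diff[OF lin(3)])
    then have "norm ((T ^^ n) (x - y)) \<le> M * \<beta> ^ n * norm (x - y)"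
      using stable[of n "x - y"] by simp
    also have "\<dots> \<le> max 1 M * \<beta> ^ n * norm (x - y)"
      using \<beta> by (intro mult_right_mono) auto
    finally show ?thesis by (simp add: dist_norm linear_diff[OF lin(3)])
  qed
  have u: "dist ((inv T ^^ n) x) ((inv T ^^ n) y) \<le> max 1 M * \<beta> ^ n * dist x y"
    if "y \<in> unstable_set 1 x T" for x y n
  proof -
    have "P (x - y) = 0"
      using that
      by (intro bounded_backward_imp_zero[of _ 1])
        (simp add: unstable_set_def dist_norm linear_diff[OF lin(4)])
    then have "norm ((inv T ^^ n) (x - y)) \<le> M * \<beta> ^ n * norm (x - y)"
      using unstable[of n "x - y"] by simp
    also have "\<dots> \<le> max 1 M * \<beta> ^ n * norm (x - y)"
      using \<beta> by (intro mult_right_mono) auto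
    finally show ?thesis by (simp add: dist_norm linear_diff[OF lin(4)])
  qed
  show "\<exists>c \<beta> \<gamma>. c \<ge> 1 \<and> 0 < \<beta> \<and> \<beta> < 1 \<and> \<gamma> > 0 \<and>
      (\<forall>x.
        (\<forall>y\<in>stable_set \<gamma> x T. \<forall>n\<ge>1. dist ((T ^^ n) x) ((T ^^ n) y) \<le> c * \<beta> ^ n * dist x y) \<and>
        (\<forall>y\<in>unstable_set \<gamma> x T. \<forall>n\<ge>1.
          dist ((inv T ^^ n) x) ((inv T ^^ n) y) \<le> c * \<beta> ^ n * dist x y))"
    by (rule exI[of _ "max 1 M"], rule exI[of _ \<beta>], rule exI[of _ 1]) (use s u \<beta> in auto)
qed

lemma imp_expansive: "expansive T"
  unfolding expansive_def
\<comment> \<open>Any constant above 1 works: a vector whose orbit stays below it has a bounded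
  orbit.\<close>
proof (rule exI[of _ 2], intro conjI ballI)
  fix x :: 'a
  assume x: "x \<in> sphere 0 1"
  show "\<exists>n. norm (zpow T n x) \<ge> 2"
  proof (rule ccontr)
    assume "\<nexists>n. norm (zpow T n x) \<ge> 2"
    then have *: "norm (zpow T n x) \<le> 2" for n
      by (meson linear order_less_imp_le not_le)
    have "x = 0"
      using bounded_orbit_zero[of x 2] *[of "int n" for n] *[of "- int n" for n]
      by (simp only: zpow_of_nat zpow_minus_of_nat)
    with x show False by simp
  qed
qed simp

text \<open>Green's function: the stable part of each past forcing term is carried forward, the
  complementary part of each present or future one is pulled back, so both series converge
  geometrically.\<close>

lemma bounded_solution:
  fixes g :: "int \<Rightarrow> 'a"
  assumes g: "\<And>n. norm (g n) \<le> \<delta>"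
  obtains y where "\<And>n. y (n + 1) = T (y n) + g n" "\<And>n. norm (y n) \<le> 2 * M * \<delta> / (1 - \<beta>)"
proof -
  \<comment> \<open>A term \<open>g m\<close> enters the orbit at time \<open>m + 1\<close>. Hence
    at time \<open>n\<close> the past term with index \<open>n - 1 - k\<close> has travelled
    \<open>k\<close> steps, while the one with index \<open>n + k\<close> has to be pulled back
    \<open>k + 1\<close> steps.\<close>
  define a where "a n k = (T ^^ k) (P (g (n - 1 - int k)))" for n k
  define b where "b n k = (inv T ^^ Suc k) (g (n + int k) - P (g (n + int k)))" for n k
  have geo: "(\<lambda>k. M * \<delta> * \<beta> ^ k) sums (M * \<delta> * (1 / (1 - \<beta>)))"
    using \<beta> by (intro sums_mult geometric_sums) auto
  have na: "norm (a n k) \<le> M * \<delta> * \<beta> ^ k" for n k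
  proof -
    have "norm (a n k) \<le> M * \<beta> ^ k * norm (g (n - 1 - int k))"
      unfolding a_def by (rule stable)
    also have "\<dots> \<le> M * \<beta> ^ k * \<delta>"
      using g M \<beta> by (intro mult_left_mono) auto
    finally show ?thesis by (simp add: mult_ac)
  qed
  have nb: "norm (b n k) \<le> M * \<delta> * \<beta> ^ k" for n k
  proof -
    have "norm (b n k) \<le> M * \<beta> ^ Suc k * norm (g (n + int k))"
      unfolding b_def by (rule unstable)
    \<comment> \<open>One factor \<beta> is given away so that both series share a majorant.\<close>
    also have "\<dots> \<le> M * \<beta> ^ k * \<delta>"
      using g M \<beta> power_decreasing[of k "Suc k" \<beta>] by (intro mult_mono) auto
    finally show ?thesis by (simp add: mult_ac)
  qed
  have sa: "summable (a n)" and sb: "summable (b n)" for n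
    by (rule summable_comparison_test'[OF sums_summable[OF geo]], rule na nb)+
  have ba: "norm (suminf (a n)) \<le> M * \<delta> / (1 - \<beta>)" for n
    using norm_suminf_le[OF na sums_summable[OF geo]] sums_unique[OF geo] by simp
  have bb: "norm (suminf (b n)) \<le> M * \<delta> / (1 - \<beta>)" for n
    using norm_suminf_le[OF nb sums_summable[OF geo]] sums_unique[OF geo] by simp
  have Ta: "suminf (a (n + 1)) = P (g n) + T (suminf (a n))" for n
  proof -
    have "suminf (a (n + 1)) = a (n + 1) 0 + (\<Sum>k. a (n + 1) (Suc k))"
      using suminf_split_head[OF sa, of "n + 1"] by simp
    also have "a (n + 1) (Suc k) = T (a n k)" for k
      by (simp add: a_def diff_diff_add)
    then have "(\<Sum>k. a (n + 1) (Suc k)) = T (suminf (a n))"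
      using bounded_linear.suminf[OF bl sa] by simp
    finally show ?thesis unfolding a_def[of "n + 1" 0] by simp
  qed
  have Tb: "T (suminf (b n)) = (g n - P (g n)) + suminf (b (n + 1))" for n
  proof -
    have Tk: "T (b n (Suc k)) = b (n + 1) k" for k
      by (simp add: b_def add_ac)
    have sT: "summable (\<lambda>k. T (b n k))"
      using bounded_linear.summable[OF bl sb] .
    have "T (suminf (b n)) = (\<Sum>k. T (b n k))"
      by (rule bounded_linear.suminf[OF bl sb])
    also have "\<dots> = T (b n 0) + (\<Sum>k. T (b n (Suc k)))"
      using suminf_split_head[OF sT] by simp
    finally show ?thesis unfolding Tk unfolding b_def[of n 0] by simp
  qed
  \<comment> \<open>The minus sign makes \<open>g n - P (g n)\<close> from \<open>Tb\<close> add up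
    with \<open>P (g n)\<close> from \<open>Ta\<close> to the forcing \<open>g n\<close>.\<close>
  define y where "y n = suminf (a n) - suminf (b n)" for n
  have "y (n + 1) = T (y n) + g n" for n
    by (simp add: y_def linear_diff[OF lin(1)] Ta Tb)
  moreover have "norm (y n) \<le> 2 * M * \<delta> / (1 - \<beta>)" for n
    using norm_triangle_ineq4[of "suminf (a n)" "suminf (b n)"] ba[of n] bb[of n]
    unfolding y_def by simp
  ultimately show thesis by (rule that)
qed

lemma imp_shadowing: "shadowing_property T"
  unfolding shadowing_property_def
proof (intro allI impI)
  fix \<epsilon> :: real
  assume \<epsilon>: "\<epsilon> > 0"
  \<comment> \<open>Chosen so that the bound of \<open>bounded_solution\<close> is
    \<open>\<epsilon> / 2\<close>, which gives the strict inequality.\<close>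
  define \<delta> where "\<delta> = \<epsilon> * (1 - \<beta>) / (4 * M)"
  have \<delta>: "\<delta> > 0" "2 * M * \<delta> / (1 - \<beta>) < \<epsilon>"
    using \<epsilon> M \<beta> by (auto simp: \<delta>_def field_simps)
  show "\<exists>\<delta>>0. \<forall>x. pseudotrajectory \<delta> T x \<longrightarrow> (\<exists>y. \<forall>n. norm (x n - zpow T n y) < \<epsilon>)"
  proof (intro exI[of _ \<delta>] conjI allI impI)
    fix x
    assume "pseudotrajectory \<delta> T x"
    \<comment> \<open>The one-step errors serve as forcing. Subtracting the bounded solution from
      the pseudotrajectory leaves a true orbit, whose point at time 0 is the shadowing
      point.\<close>
    then have "norm (x (n + 1) - T (x n)) \<le> \<delta>" for n
      by (simp add: pseudotrajectory_def norm_minus_commute)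
    from bounded_solution[of "\<lambda>n. x (n + 1) - T (x n)", OF this]
    obtain y where y: "\<And>n. y (n + 1) = T (y n) + (x (n + 1) - T (x n))"
        "\<And>n. norm (y n) \<le> 2 * M * \<delta> / (1 - \<beta>)"
      by blast
    have "x n - y n = zpow T n (x 0 - y 0)" for n
      by (rule zpow_eqI[OF bij]) (simp add: y(1) linear_diff[OF lin(1)])
    then have "x n - zpow T n (x 0 - y 0) = y n" for n
      by (metis diff_diff_eq2 add_diff_cancel_left')
    then have "norm (x n - zpow T n (x 0 - y 0)) < \<epsilon>" for n
      using y(2)[of n] \<delta>(2) by simp
    then show "\<exists>y. \<forall>n. norm (x n - zpow T n y) < \<epsilon>" by blast
  qed (rule \<delta>(1))
qed

end

lemma exponential_dichotomy_locale:
  fixes T :: "'a::banach \<Rightarrow> 'a"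
  assumes "bounded_linear T" "bij T" "exponential_dichotomy T"
  obtains P M \<beta> where "dichotomy T P M \<beta>"
proof -
  obtain P M \<beta> where "0 < M" "0 < \<beta>" "\<beta> < 1" "\<And>x. P (T x) = T (P x)"
    "\<And>x n. norm ((T ^^ n) (P x)) \<le> M * \<beta> ^ n * norm x"
    "\<And>x n. norm ((inv T ^^ n) (x - P x)) \<le> M * \<beta> ^ n * norm x"
    using assms(3) unfolding exponential_dichotomy_def by blast
  with assms(1,2) have "dichotomy T P M \<beta>" by (rule dichotomy.intro)
  then show thesis by (rule that)
qed

section \<open>From hyperbolic coordinates to a dichotomy\<close>

text \<open>The rate is known only for orbits that stay within \<gamma>. A bounded orbit gets there
  by scaling its starting vector, and both sides of the estimate are homogeneous.\<close>

lemma funpow_bounded_by_scaling: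
  fixes U :: "'a::real_normed_vector \<Rightarrow> 'a"
  assumes lin: "\<And>n. linear (U ^^ n)" and \<gamma>: "\<gamma> > 0"
    and contr: "\<And>y n. (\<And>m. norm ((U ^^ m) y) \<le> \<gamma>) \<Longrightarrow> n \<ge> 1 \<Longrightarrow> norm ((U ^^ n) y) \<le> c * \<beta> ^ n * norm y"
    and c: "c \<ge> 1" and B: "\<And>m. norm ((U ^^ m) y) \<le> B"
  shows "norm ((U ^^ n) y) \<le> c * \<beta> ^ n * norm y"
proof (cases "n = 0")
  case True
  then show ?thesis using c by (simp add: mult_le_cancel_right1)
next
  case False
  define r where "r = \<gamma> / (\<bar>B\<bar> + 1)"
  have r: "r > 0" using \<gamma> by (simp add: r_def)
  have "norm ((U ^^ m) (r *\<^sub>R y)) \<le> \<gamma>" for m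
  proof -
    have "norm ((U ^^ m) (r *\<^sub>R y)) = r * norm ((U ^^ m) y)"
      using r by (simp add: linear_scale[OF lin])
    also have "\<dots> \<le> r * (\<bar>B\<bar> + 1)"
      using r B[of m] by (intro mult_left_mono) auto
    also have "\<dots> = \<gamma>" by (simp add: r_def)
    finally show ?thesis .
  qed
  from contr[OF this, of n] False
  have "r * norm ((U ^^ n) y) \<le> r * (c * \<beta> ^ n * norm y)"
    using r by (simp add: linear_scale[OF lin] mult_ac)
  with r show ?thesis by simp
qed

text \<open>\<open>E\<close> and \<open>F\<close> are the spaces of vectors with bounded forward and
  bounded backward orbits. The rates make them meet only in 0, canonical coordinates make them span,
  and \<open>P\<close> picks the \<open>E\<close>-part; uniqueness of the splitting makes it commute
  with \<open>T\<close>.\<close>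

lemma hyperbolic_coordinates_imp_dichotomy:
  fixes T :: "'a::banach \<Rightarrow> 'a"
  assumes bl: "bounded_linear T" and bij: "bij T" and hc: "hyperbolic_coordinates T"
  shows "exponential_dichotomy T"
proof -
  have lin: "linear T" "linear (inv T)" "linear (T ^^ n)" "linear (inv T ^^ n)" for n
    using bl bij linear_inv_bij linear_funpow bounded_linear.linear by blast+
  have inv: "inv T (T x) = x" "T (inv T x) = x" for x
    using bij by (simp_all add: bij_is_inj bij_is_surj surj_f_inv_f)
  obtain c \<beta> \<gamma> where c: "c \<ge> 1" and \<beta>: "0 < \<beta>" "\<beta> < 1" and \<gamma>: "\<gamma> > 0"
    and s: "\<And>x y n. y \<in> stable_set \<gamma> x T \<Longrightarrow> n \<ge> 1 \<Longrightarrow>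
      dist ((T ^^ n) x) ((T ^^ n) y) \<le> c * \<beta> ^ n * dist x y"
    and u: "\<And>x y n. y \<in> unstable_set \<gamma> x T \<Longrightarrow> n \<ge> 1 \<Longrightarrow>
      dist ((inv T ^^ n) x) ((inv T ^^ n) y) \<le> c * \<beta> ^ n * dist x y"
    using hc unfolding hyperbolic_coordinates_def by metis
  define E where "E = {v. \<exists>B. \<forall>n. norm ((T ^^ n) v) \<le> B}"
  define F where "F = {v. \<exists>B. \<forall>n. norm ((inv T ^^ n) v) \<le> B}"
  have E: "norm ((T ^^ n) v) \<le> c * \<beta> ^ n * norm v" if vE: "v \<in> E" for v n
  proof -
    obtain B where B: "\<And>n. norm ((T ^^ n) v) \<le> B" using vE by (auto simp: E_def)
    show ?thesis
    proof (rule funpow_bounded_by_scaling[OF lin(3) \<gamma> _ c B])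
      show "norm ((T ^^ n) y) \<le> c * \<beta> ^ n * norm y"
        if "\<And>m. norm ((T ^^ m) y) \<le> \<gamma>" "n \<ge> 1" for y n
        using s[of y 0 n] that by (simp add: stable_set_def linear_0[OF lin(3)])
    qed
  qed
  have F: "norm ((inv T ^^ n) v) \<le> c * \<beta> ^ n * norm v" if vF: "v \<in> F" for v n
  proof -
    obtain B where B: "\<And>n. norm ((inv T ^^ n) v) \<le> B" using vF by (auto simp: F_def)
    show ?thesis
    proof (rule funpow_bounded_by_scaling[OF lin(4) \<gamma> _ c B])
      show "norm ((inv T ^^ n) y) \<le> c * \<beta> ^ n * norm y"
        if "\<And>m. norm ((inv T ^^ m) y) \<le> \<gamma>" "n \<ge> 1" for y n
        using u[of y 0 n] that by (simp add: unstable_set_def linear_0[OF lin(4)])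
    qed
  qed
  have Ediff: "v - w \<in> E" if vw: "v \<in> E" "w \<in> E" for v w
  proof -
    obtain B C where "\<And>n. norm ((T ^^ n) v) \<le> B" "\<And>n. norm ((T ^^ n) w) \<le> C"
      using vw by (auto simp: E_def)
    then have "norm ((T ^^ n) (v - w)) \<le> B + C" for n
      unfolding linear_diff[OF lin(3)] by (meson add_mono norm_triangle_ineq4 order_trans)
    then show ?thesis by (auto simp: E_def)
  qed
  have Fdiff: "v - w \<in> F" if vw: "v \<in> F" "w \<in> F" for v w
  proof -
    obtain B C where "\<And>n. norm ((inv T ^^ n) v) \<le> B" "\<And>n. norm ((inv T ^^ n) w) \<le> C"
      using vw by (auto simp: F_def)
    then have "norm ((inv T ^^ n) (v - w)) \<le> B + C" for n
      unfolding linear_diff[OF lin(4)] by (meson add_mono norm_triangle_ineq4 order_trans)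
    then show ?thesis by (auto simp: F_def)
  qed
  have TE: "T v \<in> E" if vE: "v \<in> E" for v
  proof -
    obtain B where B: "\<And>n. norm ((T ^^ n) v) \<le> B" using vE by (auto simp: E_def)
    then have "norm ((T ^^ n) (T v)) \<le> B" for n
      using B[of "Suc n"] by (simp add: funpow_swap1)
    then show ?thesis by (auto simp: E_def)
  qed
  have TF: "T v \<in> F" if vF: "v \<in> F" for v
  proof -
    obtain B where B: "\<And>n. norm ((inv T ^^ n) v) \<le> B" using vF by (auto simp: F_def)
    \<comment> \<open>Shifting an orbit against its direction adds one point, at n = 0; the maximum
      covers it.\<close>
    have "norm ((inv T ^^ n) (T v)) \<le> max B (norm (T v))" for n
    proof (cases n)
      case (Suc m)
      then have "(inv T ^^ n) (T v) = (inv T ^^ m) v"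
        by (simp add: funpow_swap1 inv)
      then show ?thesis using B[of m] by simp
    qed simp
    then show ?thesis by (auto simp: F_def)
  qed
  have ET: "inv T v \<in> E" if vE: "v \<in> E" for v
  proof -
    obtain B where B: "\<And>n. norm ((T ^^ n) v) \<le> B" using vE by (auto simp: E_def)
    have "norm ((T ^^ n) (inv T v)) \<le> max B (norm (inv T v))" for n
    proof (cases n)
      case (Suc m)
      then have "(T ^^ n) (inv T v) = (T ^^ m) v"
        by (simp add: funpow_swap1 inv)
      then show ?thesis using B[of m] by simp
    qed simp
    then show ?thesis by (auto simp: E_def)
  qed
  have EF0: "v = 0" if v: "v \<in> E" "v \<in> F" for v
  proof -
    \<comment> \<open>Going back n steps shrinks \<open>v\<close> by the rate on \<open>F\<close>,
      and returning shrinks it again by the rate on \<open>E\<close>.\<close>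
    have "norm v \<le> (c * c * norm v) * (\<beta> * \<beta>) ^ n" for n
    proof -
      have "(inv T ^^ n) v \<in> E" by (induction n) (simp_all add: v(1) ET)
      then have "norm v \<le> c * \<beta> ^ n * norm ((inv T ^^ n) v)"
        using E[of "(inv T ^^ n) v" n] by (simp add: inv_funpow_cancel[OF bij])
      also have "\<dots> \<le> c * \<beta> ^ n * (c * \<beta> ^ n * norm v)"
        using F[OF v(2)] c \<beta> by (intro mult_left_mono) auto
      finally show ?thesis by (simp add: power_mult_distrib mult_ac)
    qed
    then have "norm v \<le> 0"
      using \<beta> by (intro le_mult_powers_imp_zero[of "\<beta> * \<beta>"]) (use mult_strict_mono[of \<beta> 1 \<beta> 1] in auto)
    then show ?thesis by simp
  qed
  have uniq: "z = w" if "z \<in> E" "w \<in> E" "v - z \<in> F" "v - w \<in> F" for v z w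
    using EF0[of "z - w"] Ediff[OF that(1,2)] Fdiff[OF that(4,3)] by simp
  obtain \<delta> where \<delta>: "\<delta> > 0"
    and cc: "\<And>x y. dist x y \<le> \<delta> \<Longrightarrow> stable_set 1 x T \<inter> unstable_set 1 y T \<noteq> {}"
    using hc unfolding hyperbolic_coordinates_def canonical_coordinates_def by (metis zero_less_one)
  have ex: "\<exists>z. z \<in> E \<and> v - z \<in> F \<and> norm z \<le> 1 / \<delta> * norm v \<and> norm (v - z) \<le> 1 / \<delta> * norm v" for v
  proof (cases "v = 0")
    case True
    then show ?thesis
      by (intro exI[of _ 0]) (auto simp: E_def F_def linear_0[OF lin(3)] linear_0[OF lin(4)])
  next
    case False
    \<comment> \<open>Scaled to norm \<delta>, \<open>v\<close> is within reach of the canonical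
      coordinates at 0. Scaling back multiplies the orbit bound 1 by \<open>r\<close>, and n = 0
      gives the norm bounds.\<close>
    define r where "r = norm v / \<delta>"
    have r: "r > 0" using False \<delta> by (simp add: r_def)
    have "dist 0 (v /\<^sub>R r) \<le> \<delta>" using False \<delta> by (simp add: r_def)
    from cc[OF this] obtain z where z: "z \<in> stable_set 1 0 T" "z \<in> unstable_set 1 (v /\<^sub>R r) T"
      by blast
    have z1: "norm ((T ^^ n) z) \<le> 1" for n
      using z(1) by (simp add: stable_set_def linear_0[OF lin(3)])
    have z2: "norm ((inv T ^^ n) (v /\<^sub>R r - z)) \<le> 1" for n
      using z(2) by (simp add: unstable_set_def dist_norm linear_diff[OF lin(4)])
    have vz: "v - r *\<^sub>R z = r *\<^sub>R (v /\<^sub>R r - z)"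
      using r by (simp add: scaleR_diff_right)
    have 1: "norm ((T ^^ n) (r *\<^sub>R z)) \<le> r" for n
      using z1[of n] r by (simp add: linear_scale[OF lin(3)] mult_le_cancel_left2)
    have 2: "norm ((inv T ^^ n) (v - r *\<^sub>R z)) \<le> r" for n
      unfolding vz using z2[of n] r by (simp add: linear_scale[OF lin(4)] mult_le_cancel_left2)
    show ?thesis
      using 1 2 1[of 0] 2[of 0]
      by (intro exI[of _ "r *\<^sub>R z"]) (auto simp: E_def F_def r_def)
  qed
  then obtain P where P: "\<And>v. P v \<in> E" "\<And>v. v - P v \<in> F" "\<And>v. norm (P v) \<le> 1 / \<delta> * norm v"
      "\<And>v. norm (v - P v) \<le> 1 / \<delta> * norm v"
    by metis
  show ?thesis
    unfolding exponential_dichotomy_def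
  proof (rule exI[of _ P], rule exI[of _ "c / \<delta>"], rule exI[of _ \<beta>], intro conjI allI)
    show "0 < c / \<delta>" using c \<delta> by simp
    show "P (T v) = T (P v)" for v
      using uniq[of "P (T v)" "T (P v)" "T v"] P(1,2) TE TF[OF P(2)[of v]]
      by (simp add: linear_diff[OF lin(1)])
    fix v :: 'a and n
    have le: "c * \<beta> ^ n * norm w \<le> c / \<delta> * \<beta> ^ n * norm v" if "norm w \<le> 1 / \<delta> * norm v" for w :: 'a
      using mult_left_mono[OF that, of "c * \<beta> ^ n"] c \<beta> by simp
    show "norm ((T ^^ n) (P v)) \<le> c / \<delta> * \<beta> ^ n * norm v"
      using E[OF P(1)] le[OF P(3)] by (rule order_trans)
    show "norm ((inv T ^^ n) (v - P v)) \<le> c / \<delta> * \<beta> ^ n * norm v"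
      using F[OF P(2)] le[OF P(4)] by (rule order_trans)
  qed (rule \<beta>)+
qed

section \<open>From expansivity and shadowing to the spectrum\<close>

text \<open>Expansivity, applied to the normalised point at any time of the orbit, finds a time at
  which the norm is larger by the factor \<open>c\<close>. Repetition yields norms of at least
  \<open>c ^ k * norm x\<close>, contrary to boundedness.\<close>

lemma expansive_bounded_orbit_zero:
  fixes T :: "'a::real_normed_vector \<Rightarrow> 'a"
  assumes lin: "linear T" and bij: "bij T" and ex: "expansive T"
    and B: "\<And>n. norm (zpow T n x) \<le> B"
  shows "x = 0"
proof (rule ccontr)
  assume x: "x \<noteq> 0"
  obtain c where c: "c > 1" and exc: "\<And>y. norm y = 1 \<Longrightarrow> \<exists>n. norm (zpow T n y) \<ge> c"
    using ex unfolding expansive_def by auto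
  have grow: "\<exists>m. norm (zpow T m x) \<ge> c * norm (zpow T n x)" for n
  proof -
    define y where "y = zpow T n x"
    \<comment> \<open>An orbit that is zero at one time is zero at time 0 as well.\<close>
    have y0: "y \<noteq> 0"
    proof
      assume "y = 0"
      have "zpow T (n + k) x = 0" for k
        using \<open>y = 0\<close> zpow_eqI[OF bij, of "\<lambda>k. zpow T (n + k) x" k] zpow_scaleR[OF lin bij, of k 0 0]
        by (simp add: y_def zpow_Suc[OF bij] flip: add.assoc)
      from this[of "- n"] x show False by simp
    qed
    obtain k where k: "norm (zpow T k (y /\<^sub>R norm y)) \<ge> c"
      using exc[of "y /\<^sub>R norm y"] y0 by auto
    have "norm (zpow T k y) \<ge> c * norm y"
      using k y0 by (simp add: zpow_scaleR[OF lin bij] field_simps)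
    moreover have "zpow T (n + k) x = zpow T k y"
      using zpow_eqI[OF bij, of "\<lambda>k. zpow T (n + k) x" k]
      by (simp add: y_def zpow_Suc[OF bij] flip: add.assoc)
    ultimately show ?thesis unfolding y_def by metis
  qed
  have pow: "\<exists>m. norm (zpow T m x) \<ge> c ^ k * norm x" for k
  proof (induction k)
    case 0
    show ?case by (rule exI[of _ 0]) simp
  next
    case (Suc k)
    then obtain n where n: "norm (zpow T n x) \<ge> c ^ k * norm x" by blast
    obtain m where "norm (zpow T m x) \<ge> c * norm (zpow T n x)" using grow by blast
    moreover have "c * norm (zpow T n x) \<ge> c * (c ^ k * norm x)"
      using n c by (intro mult_left_mono) auto
    ultimately show ?case by (intro exI[of _ m]) (simp add: mult_ac)
  qed
  obtain k where "c ^ k > B / norm x" using real_arch_pow[OF c] by blast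
  then have "c ^ k * norm x > B" using x by (simp add: field_simps)
  then show False using pow[of k] B by (meson not_le order_trans)
qed

lemma forced_orbit_ex:
  fixes T :: "'a::real_normed_vector \<Rightarrow> 'a"
  assumes "bij T"
  obtains x where "\<And>n::int. x (n + 1) = T (x n) + f n"
proof -
  define u where "u = rec_nat (0::'a) (\<lambda>n z. T z + f (int n))"
  \<comment> \<open>\<open>v l\<close> is the value at time \<open>- l\<close>. The next value
    solves the recursion at time \<open>- l - 1\<close> for its right-hand orbit point, hence the
    index of the forcing term.\<close>
  define v where "v = rec_nat (0::'a) (\<lambda>n z. inv T (z - f (- int n - 1)))"
  define x where "x n = (if n \<ge> 0 then u (nat n) else v (nat (- n)))" for n
  have "x (n + 1) = T (x n) + f n" for n
  proof (cases n rule: int_cases2)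
    case (nonneg m)
    then have "nat (n + 1) = Suc m" by simp
    then show ?thesis using nonneg by (simp add: x_def u_def)
  next
    case (nonpos m)
    show ?thesis
    proof (cases m)
      case 0
      then show ?thesis using nonpos by (simp add: x_def u_def)
    next
      case (Suc l)
      then have n: "n = - int l - 1" using nonpos by simp
      have "x (n + 1) = v l" unfolding x_def n by (cases "l = 0") (auto simp: u_def v_def)
      moreover have "x n = inv T (v l - f n)"
        unfolding x_def n by (simp add: nat_add_distrib) (simp add: v_def)
      ultimately show ?thesis using assms by (simp add: bij_is_surj surj_f_inv_f)
    qed
  qed
  then show thesis by (rule that)
qed

text \<open>A forced orbit with small forcing is a pseudotrajectory. Its difference from a shadowing
  orbit is bounded and obeys the same recursion; scaling back restores the original forcing.\<close>

lemma shadowing_imp_bounded_solution: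
  fixes T :: "'a::real_normed_vector \<Rightarrow> 'a" and f :: "int \<Rightarrow> 'a"
  assumes lin: "linear T" and bij: "bij T" and sh: "shadowing_property T"
    and f: "\<And>n. norm (f n) \<le> K"
  obtains x B where "\<And>n. x (n + 1) = T (x n) + f n" "\<And>n. norm (x n) \<le> B"
proof -
  obtain \<delta> where \<delta>: "\<delta> > 0" and sh1: "\<And>x. pseudotrajectory \<delta> T x \<Longrightarrow> \<exists>y. \<forall>n. norm (x n - zpow T n y) < 1"
    using sh unfolding shadowing_property_def by (metis zero_less_one)
  have K: "K \<ge> 0" using f[of 0] norm_ge_zero order_trans by blast
  \<comment> \<open>The added 1 covers \<open>K = 0\<close>.\<close>
  define r where "r = \<delta> / (K + 1)"
  have r: "r > 0" "r * K \<le> \<delta>" using \<delta> K by (auto simp: r_def field_simps)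
  obtain x where x: "\<And>n. x (n + 1) = T (x n) + r *\<^sub>R f n"
    using forced_orbit_ex[OF bij, of "\<lambda>n. r *\<^sub>R f n"] by blast
  have "norm (r *\<^sub>R f n) \<le> \<delta>" for n
    using order_trans[OF mult_left_mono[OF f[of n], of r] r(2)] r(1) by simp
  then have "pseudotrajectory \<delta> T x"
    unfolding pseudotrajectory_def x by simp
  then obtain y where y: "\<And>n. norm (x n - zpow T n y) < 1" using sh1 by blast
  define z where "z n = (x n - zpow T n y) /\<^sub>R r" for n
  have "z (n + 1) = T (z n) + f n" for n
  proof -
    have "z (n + 1) = (T (x n - zpow T n y) + r *\<^sub>R f n) /\<^sub>R r"
      by (simp add: z_def x zpow_Suc[OF bij] linear_diff[OF lin])
    then show ?thesis
      using r(1) by (simp add: z_def linear_scale[OF lin] scaleR_add_right)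
  qed
  moreover have "norm (z n) \<le> inverse r" for n
    using y[of n] r(1) by (simp add: z_def del: scaleR_right_diff_distrib)
  ultimately show thesis by (rule that)
qed

section \<open>Complex scalars, and bijectivity of \<open>S - l\<close> for \<open>l\<close> on the
  unit circle\<close>

lemma scaleC_zero_right [simp]: "a *\<^sub>C (0::'a::complex_normed_vector) = 0"
  using scaleC_add_right[of a 0 0] by simp

lemma scaleC_zero_left [simp]: "0 *\<^sub>C (x::'a::complex_normed_vector) = 0"
  using scaleC_of_real[of 0 x] by simp

lemma scaleC_one [simp]: "1 *\<^sub>C (x::'a::complex_normed_vector) = x"
  using scaleC_of_real[of 1 x] by simp

lemma scaleC_minus_right: "a *\<^sub>C (- (x::'a::complex_normed_vector)) = - (a *\<^sub>C x)"
  using scaleC_add_right[of a x "- x"] by (simp add: eq_neg_iff_add_eq_0 add.commute)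

lemma scaleC_minus_left: "(- a) *\<^sub>C (x::'a::complex_normed_vector) = - (a *\<^sub>C x)"
  using scaleC_add_left[of a "- a" x] by (simp add: eq_neg_iff_add_eq_0 add.commute)

lemma scaleC_diff_right: "a *\<^sub>C (x - (y::'a::complex_normed_vector)) = a *\<^sub>C x - a *\<^sub>C y"
  using scaleC_add_right[of a x "- y"] by (simp add: scaleC_minus_right)

lemma scaleC_diff_left: "(a - b) *\<^sub>C (x::'a::complex_normed_vector) = a *\<^sub>C x - b *\<^sub>C x"
  using scaleC_add_left[of a "- b" x] by (simp add: scaleC_minus_left)

lemma scaleR_scaleC_commute:
  "r *\<^sub>R a *\<^sub>C (x::'a::complex_normed_vector) = a *\<^sub>C r *\<^sub>R x"
  by (simp flip: scaleC_of_real add: scaleC_scaleC mult.commute)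

lemma bounded_linear_scaleC: "bounded_linear (\<lambda>x::'a::complex_normed_vector. a *\<^sub>C x)"
  by (rule bounded_linear_intro[of _ "cmod a"])
    (simp_all add: scaleC_add_right scaleR_scaleC_commute norm_scaleC mult.commute)

lemma scaleC_eq_0_iff: "a *\<^sub>C (x::'a::complex_normed_vector) = 0 \<longleftrightarrow> a = 0 \<or> x = 0"
  using norm_scaleC[of a x] by (metis mult_eq_0_iff norm_eq_zero)

text \<open>\<open>sol\<close> and \<open>uniq\<close> are what shadowing and expansivity provide;
  in this form they pass to a complexification part by part. As \<open>l\<close> has modulus 1, its
  integer powers are bounded and give admissible orbits and forcings.\<close>

lemma bij_minus_eigenvalue:
  fixes S :: "'b::complex_normed_vector \<Rightarrow> 'b"
  assumes S: "bounded_clinear S" "bij S" and l: "cmod l = 1"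
    and sol: "\<And>f K. (\<And>n. norm (f n) \<le> K) \<Longrightarrow>
      \<exists>x B. (\<forall>n::int. x (n + 1) = S (x n) + f n) \<and> (\<forall>n. norm (x n) \<le> B)"
    and uniq: "\<And>x B. (\<And>n. norm (zpow S n x) \<le> B) \<Longrightarrow> x = 0"
  shows "bij (\<lambda>x. S x - l *\<^sub>C x)"
proof -
  have lin: "linear S" and Sl: "\<And>a x. S (a *\<^sub>C x) = a *\<^sub>C S x"
    using S(1) by (auto simp: bounded_clinear_def bounded_linear.linear)
  have l0: "l \<noteq> 0" using l by auto
  have powi: "l powi (n + 1) = l * l powi n" for n
    using l0 by (simp add: power_int_add)
  have npow: "cmod (l powi n) = 1" for n
    by (simp add: norm_power_int l)
  have zero: "x n = 0" if x: "\<And>n. x (n + 1) = S (x n)" "\<And>n::int. norm (x n) \<le> B"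
    for x :: "int \<Rightarrow> 'b" and B n
  proof -
    have "x 0 = 0"
      using uniq[of "x 0" B] x(2) by (simp flip: zpow_eqI[of S x, OF S(2) x(1)])
    moreover have "zpow S n 0 = 0" for n
      using zpow_scaleR[OF lin S(2), of n 0 0] by simp
    ultimately show ?thesis using zpow_eqI[of S x n, OF S(2) x(1)] by simp
  qed
  show ?thesis
  proof (rule bijI)
    show "inj (\<lambda>x. S x - l *\<^sub>C x)"
    proof (rule injI)
      fix x y assume eq: "S x - l *\<^sub>C x = S y - l *\<^sub>C y"
      define w where "w = x - y"
      have w: "S w = l *\<^sub>C w"
        using eq by (simp add: w_def linear_diff[OF lin] scaleC_diff_right algebra_simps)
      \<comment> \<open>An eigenvector \<open>w\<close> with eigenvalue \<open>l\<close> has the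
        bounded orbit \<open>l powi n *\<^sub>C w\<close>, which must be zero.\<close>
      have "l powi 0 *\<^sub>C w = 0"
        by (rule zero[of "\<lambda>n. l powi n *\<^sub>C w" "norm w"])
          (simp_all add: powi Sl w scaleC_scaleC norm_scaleC npow mult.commute)
      then show "x = y" by (simp add: w_def)
    qed
    show "surj (\<lambda>x. S x - l *\<^sub>C x)"
      unfolding surj_def
    proof (intro allI)
      fix y :: 'b
      have "norm (l powi n *\<^sub>C y) \<le> norm y" for n by (simp add: norm_scaleC npow)
      from sol[of "\<lambda>n. l powi n *\<^sub>C y", OF this] obtain x B where
        x: "\<And>n. x (n + 1) = S (x n) + l powi n *\<^sub>C y" and B: "\<And>n. norm (x n) \<le> B"
        by blast
      txt \<open>The sequence \<open>l\<^sup>-\<^sup>1 x (n + 1)\<close> solves the same inhomogeneous equation,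
        so uniqueness forces \<open>x n = l\<^sup>n x 0\<close>.\<close>
      have "x (0 + 1) - l *\<^sub>C x 0 = 0"
      proof (rule zero[of "\<lambda>n. x (n + 1) - l *\<^sub>C x n" "B + B"])
        show "x (n + 1 + 1) - l *\<^sub>C x (n + 1) = S (x (n + 1) - l *\<^sub>C x n)" for n
          by (simp only: x[of "n + 1"] x[of n])
            (simp add: powi scaleC_scaleC scaleC_add_right linear_add[OF lin] linear_diff[OF lin] Sl)
        show "norm (x (n + 1) - l *\<^sub>C x n) \<le> B + B" for n
          using norm_triangle_ineq4[of "x (n + 1)" "l *\<^sub>C x n"] B[of n] B[of "n + 1"]
          by (simp add: norm_scaleC l)
      qed
      then have "S (x 0) - l *\<^sub>C x 0 = - y"
        using x[of 0] by (simp add: algebra_simps)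
      then have "y = S (- x 0) - l *\<^sub>C (- x 0)"
        by (simp add: linear_neg[OF lin] scaleC_minus_right algebra_simps)
      then show "\<exists>x. y = S x - l *\<^sub>C x" by blast
    qed
  qed
qed

lemma expansive_shadowing_imp_complex_hyperbolic:
  fixes S :: "'b::complex_banach \<Rightarrow> 'b"
  assumes S: "bounded_clinear S" "bij S" and ex: "expansive S" and sh: "shadowing_property S"
  shows "complex_hyperbolic S"
proof -
  have lin: "linear S" using S(1) by (auto simp: bounded_clinear_def bounded_linear.linear)
  have "bij (\<lambda>x. S x - l *\<^sub>C x)" if "cmod l = 1" for l
  proof (rule bij_minus_eigenvalue[OF S that])
    show "x = 0" if "\<And>n. norm (zpow S n x) \<le> B" for x B
      by (rule expansive_bounded_orbit_zero[OF lin S(2) ex that])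
    show "\<exists>x B. (\<forall>n::int. x (n + 1) = S (x n) + f n) \<and> (\<forall>n. norm (x n) \<le> B)"
      if "\<And>n. norm (f n) \<le> K" for f K
      using shadowing_imp_bounded_solution[OF lin S(2) sh, of f K, OF that] by metis
  qed
  then show ?thesis by (auto simp: complex_hyperbolic_def spectrum_def)
qed

section \<open>Powers of a complexified operator, and the real case\<close>

lemma inv_complexify_funpow:
  fixes T :: "'a \<Rightarrow> 'a"
  assumes "bij T"
  shows "(inv (complexify T) ^^ n) z = complexify (inv T ^^ n) z"
proof -
  have "complexify (inv T) (complexify T z) = z" "complexify T (complexify (inv T) z) = z" for z
    using assms by (simp_all add: complexify_def bij_is_inj bij_is_surj surj_f_inv_f)
  then have "inv (complexify T) = complexify (inv T)"
    by (intro inv_equality) auto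
  then show ?thesis
    by (induction n) (simp_all add: complexify_def)
qed

lemma complexify_funpow: "(complexify T ^^ n) z = complexify (T ^^ n) z"
  by (induction n) (simp_all add: complexify_def)

lemma zpow_complexify:
  assumes "bij T"
  shows "zpow (complexify T) n z = complexify (zpow T n) z"
  by (simp add: zpow_def complexify_funpow inv_complexify_funpow[OF assms])

lemma bij_complexify:
  assumes "bij T"
  shows "bij (complexify T)"
  using assms
  by (intro o_bij[of "complexify (inv T)"])
    (auto simp: fun_eq_iff complexify_def bij_is_inj bij_is_surj surj_f_inv_f)

text \<open>A bounded complex orbit is a pair of bounded real ones, and a bounded complex forcing is
  a pair of bounded real forcings, so uniqueness and solvability carry over to the complexification
  in each part.\<close>

lemma expansive_shadowing_imp_real_hyperbolic:
  fixes T :: "'a::banach \<Rightarrow> 'a"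
  assumes T: "bounded_linear T" "bij T" and ex: "expansive T" and sh: "shadowing_property T"
  shows "real_hyperbolic T"
proof -
  have lin: "linear T" using T(1) by (rule bounded_linear.linear)
  have "bij (\<lambda>x. complexify T x - l *\<^sub>C x)" if "cmod l = 1" for l
  proof (rule bij_minus_eigenvalue[OF bounded_clinear_complexify[OF T(1)] bij_complexify[OF T(2)] that])
    show "z = 0" if z: "\<And>n. norm (zpow (complexify T) n z) \<le> B" for z B
    proof -
      have "norm (zpow T n (re_part z)) \<le> B" "norm (zpow T n (im_part z)) \<le> B" for n
        using norm_re_part_le[of "zpow (complexify T) n z"]
          norm_im_part_le[of "zpow (complexify T) n z"] z[of n]
        by (simp_all add: zpow_complexify[OF T(2)] complexify_def)
      then have "re_part z = 0" "im_part z = 0"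
        using expansive_bounded_orbit_zero[OF lin T(2) ex] by blast+
      then show ?thesis by (cases z) (simp add: zero_complexification_def)
    qed
    show "\<exists>z B. (\<forall>n::int. z (n + 1) = complexify T (z n) + f n) \<and> (\<forall>n. norm (z n) \<le> B)"
      if f: "\<And>n. norm (f n) \<le> K" for f K
    proof -
      have "norm (re_part (f n)) \<le> K" "norm (im_part (f n)) \<le> K" for n
        using norm_re_part_le[of "f n"] norm_im_part_le[of "f n"] f[of n] by linarith+
      then obtain x B y C where x: "\<And>n. x (n + 1) = T (x n) + re_part (f n)" "\<And>n. norm (x n) \<le> B"
        and y: "\<And>n. y (n + 1) = T (y n) + im_part (f n)" "\<And>n. norm (y n) \<le> C"
        using shadowing_imp_bounded_solution[OF lin T(2) sh, of "\<lambda>n. re_part (f n)" K]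
          shadowing_imp_bounded_solution[OF lin T(2) sh, of "\<lambda>n. im_part (f n)" K] by metis
      show ?thesis
      proof (intro exI[of _ "\<lambda>n. Cplx (x n) (y n)"] exI[of _ "B + C"] conjI allI)
        show "Cplx (x (n + 1)) (y (n + 1)) = complexify T (Cplx (x n) (y n)) + f n" for n
          by (simp add: x y complexify_def plus_complexification_def)
        show "norm (Cplx (x n) (y n)) \<le> B + C" for n
          using norm_complexification_le_sum[of "Cplx (x n) (y n)"] x(2)[of n] y(2)[of n] by simp
      qed
    qed
  qed
  then show ?thesis by (auto simp: real_hyperbolic_def spectrum_def)
qed

section \<open>Bounded inverses\<close>

text \<open>Each correction at least halves the remaining error; the corrections sum to a solution
  of norm at most \<open>C * norm y\<close> times 1 + 1/2 + 1/4 + ...\<close>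

lemma approximate_solution_imp_solution:
  fixes f :: "'a::banach \<Rightarrow> 'b::real_normed_vector"
  assumes f: "bounded_linear f" and C: "C \<ge> 0"
    and appr: "\<And>y. \<exists>x. norm x \<le> C * norm y \<and> norm (y - f x) \<le> norm y / 2"
  shows "\<exists>x. f x = y \<and> norm x \<le> 2 * C * norm y"
proof -
  obtain g where g: "\<And>y. norm (g y) \<le> C * norm y" "\<And>y. norm (y - f (g y)) \<le> norm y / 2"
    using appr by metis
  \<comment> \<open>\<open>r n\<close> is the error left after n corrections. Its differences are
    the images of the corrections, so the image of their sum telescopes to \<open>y\<close>.\<close>
  define r where "r = rec_nat y (\<lambda>_ z. z - f (g z))"
  have r0: "r 0 = y" and rS: "r (Suc n) = r n - f (g (r n))" for n
    by (simp_all add: r_def)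
  have rn: "norm (r n) \<le> norm y * (1/2) ^ n" for n
  proof (induction n)
    case (Suc n)
    then show ?case using g(2)[of "r n"] by (simp add: rS)
  qed (simp add: r0)
  have gn: "norm (g (r n)) \<le> C * norm y * (1/2) ^ n" for n
    using g(1)[of "r n"] mult_left_mono[OF rn C, of n] by simp
  have geo: "(\<lambda>n. C * norm y * (1/2) ^ n) sums (C * norm y * 2)"
    using sums_mult[OF geometric_sums[of "1/2::real"], of "C * norm y"] by simp
  have sm: "summable (\<lambda>n. g (r n))"
    by (rule summable_comparison_test'[OF sums_summable[OF geo]], rule gn)
  define x where "x = (\<Sum>n. g (r n))"
  have "norm x \<le> C * norm y * 2"
    unfolding x_def using norm_suminf_le[OF gn sums_summable[OF geo]] sums_unique[OF geo] by simp
  moreover have "f x = y"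
  proof -
    have "(\<lambda>n. norm y * (1/2) ^ n) \<longlonglongrightarrow> 0"
      using LIMSEQ_power_zero[of "1/2::real"] tendsto_mult_right_zero by auto
    then have "r \<longlonglongrightarrow> 0"
      by (rule Lim_null_comparison[rotated]) (simp add: rn)
    then have "(\<lambda>n. r n - r (Suc n)) sums (r 0 - 0)"
      by (rule telescope_sums')
    then have "(\<lambda>n. f (g (r n))) sums y" by (simp add: rS r0)
    moreover have "(\<lambda>n. f (g (r n))) sums f x"
      unfolding x_def by (rule bounded_linear.sums[OF f summable_sums[OF sm]])
    ultimately show ?thesis using sums_unique2 by blast
  qed
  ultimately show ?thesis by (intro exI[of _ x]) simp
qed

text \<open>The surjective case of the open mapping theorem: by Baire's theorem some closure of
  \<open>f ` cball 0 n\<close> contains a ball, and its symmetric translate contains a ball about 0.\<close>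

lemma surj_bounded_linear_bounded_preimages:
  fixes f :: "'a::banach \<Rightarrow> 'b::banach"
  assumes f: "bounded_linear f" and surj: "surj f"
  obtains C where "C > 0" "\<And>y. \<exists>x. f x = y \<and> norm x \<le> C * norm y"
proof -
  have lin: "linear f" using f by (rule bounded_linear.linear)
  define \<G> where "\<G> = range (\<lambda>n::nat. closure (f ` cball 0 (real n)))"
  have "\<Union>\<G> = UNIV"
  proof -
    have "y \<in> \<Union>\<G>" for y
    proof -
      obtain x where x: "y = f x" using surj by (metis surjD)
      obtain n where "norm x \<le> real n" using real_arch_simple by blast
      then have "y \<in> f ` cball 0 (real n)" using x by auto
      then have "y \<in> closure (f ` cball 0 (real n))" by (rule subsetD[OF closure_subset])
      then show ?thesis unfolding \<G>_def by auto
    qed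
    then show ?thesis by blast
  qed
  have "\<exists>n. interior (closure (f ` cball 0 (real n))) \<noteq> {}"
  proof (rule ccontr)
    assume "\<nexists>n. interior (closure (f ` cball 0 (real n))) \<noteq> {}"
    then have "Met_TC.mtopology interior_of \<Union>\<G> = {}"
      by (intro Met_TC.metric_Baire_category_alt)
        (auto simp: \<G>_def Met_TC.mcomplete_def convergent_def[symmetric] Cauchy_convergent_iff)
    then show False unfolding \<open>\<Union>\<G> = UNIV\<close> by simp
  qed
  then obtain n y0 e where e: "e > 0" and ball: "ball y0 e \<subseteq> closure (f ` cball 0 (real n))"
    by (metis equals0I mem_interior)
  have dense: "\<exists>x. norm x \<le> 2 * real n \<and> norm (y - f x) < d" if y: "norm y < e" and d: "d > 0" for y d
  proof -
    have "y0 + y \<in> closure (f ` cball 0 (real n))" "y0 \<in> closure (f ` cball 0 (real n))"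
      using subsetD[OF ball, of "y0 + y"] subsetD[OF ball, of y0] y e by (auto simp: dist_norm)
    moreover have "\<exists>a. norm a \<le> real n \<and> dist (f a) z < d / 2"
      if "z \<in> closure (f ` cball 0 (real n))" for z
      using closure_approachableD[OF that, of "d / 2"] d by (auto simp: dist_commute)
    ultimately obtain a b where ab: "norm a \<le> real n" "dist (f a) (y0 + y) < d / 2"
        "norm b \<le> real n" "dist (f b) y0 < d / 2"
      by metis
    have "y - f (a - b) = (f b - y0) - (f a - (y0 + y))"
      by (simp add: linear_diff[OF lin])
    then have "norm (y - f (a - b)) \<le> norm (f b - y0) + norm (f a - (y0 + y))"
      by (metis norm_triangle_ineq4)
    then have "norm (y - f (a - b)) < d" using ab(2,4) by (simp add: dist_norm)
    moreover have "norm (a - b) \<le> 2 * real n"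
      using norm_triangle_ineq4[of a b] ab(1,3) by simp
    ultimately show ?thesis by blast
  qed
  \<comment> \<open>Scaling \<open>y\<close> to norm \<open>e / 2\<close> and taking an approximate
    preimage of norm at most \<open>2 * n\<close> costs \<open>4 * n / e\<close> per unit of norm;
    the added 1 keeps \<open>C\<close> positive.\<close>
  define C where "C = 4 * real n / e + 1"
  have C: "C > 0" using e by (simp add: C_def add_nonneg_pos)
  have appr: "\<exists>x. norm x \<le> C * norm y \<and> norm (y - f x) \<le> norm y / 2" for y
  proof (cases "y = 0")
    case True
    then show ?thesis by (intro exI[of _ 0]) (simp add: linear_0[OF lin])
  next
    case False
    define r where "r = 2 * norm y / e"
    have r: "r > 0" using False e by (simp add: r_def)
    have "norm (y /\<^sub>R r) < e" using False e by (simp add: r_def)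
    \<comment> \<open>This accuracy becomes \<open>norm y / 2\<close> after scaling back by
      \<open>r\<close>.\<close>
    from dense[OF this, of "norm y / (2 * r)"] obtain x where
      x: "norm x \<le> 2 * real n" "norm (y /\<^sub>R r - f x) < norm y / (2 * r)"
      using r False by auto
    have "y - f (r *\<^sub>R x) = r *\<^sub>R (y /\<^sub>R r - f x)"
      using r by (simp add: linear_scale[OF lin] scaleR_diff_right)
    then have "norm (y - f (r *\<^sub>R x)) = r * norm (y /\<^sub>R r - f x)"
      using r by (simp del: scaleR_right_diff_distrib)
    also have "\<dots> \<le> r * (norm y / (2 * r))"
      using x(2) r by (intro mult_left_mono) auto
    finally have "norm (y - f (r *\<^sub>R x)) \<le> norm y / 2"
      using r by simp
    moreover have "norm (r *\<^sub>R x) \<le> r * (2 * real n)"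
      using x(1) r by simp
    moreover have "r * (2 * real n) \<le> C * norm y"
      using e by (simp add: r_def C_def field_simps)
    ultimately show ?thesis by (intro exI[of _ "r *\<^sub>R x"]) linarith
  qed
  show thesis
  proof (rule that)
    show "2 * C > 0" using C by simp
    show "\<exists>x. f x = y \<and> norm x \<le> 2 * C * norm y" for y
      by (rule approximate_solution_imp_solution[OF f _ appr]) (use C in simp)
  qed
qed

lemma bij_bounded_linear_bounded_below:
  fixes f :: "'a::banach \<Rightarrow> 'b::banach"
  assumes f: "bounded_linear f" and bij: "bij f"
  obtains c where "c > 0" "\<And>x. c * norm x \<le> norm (f x)"
proof -
  obtain C where C: "C > 0" and ex: "\<And>y. \<exists>x. f x = y \<and> norm x \<le> C * norm y"
    using surj_bounded_linear_bounded_preimages[OF f bij_is_surj[OF bij]] by blast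
  have "inverse C * norm x \<le> norm (f x)" for x
  proof -
    obtain x' where "f x' = f x" "norm x' \<le> C * norm (f x)" using ex by blast
    then have "norm x \<le> C * norm (f x)" using bij by (metis bij_is_inj injD)
    then show ?thesis using C by (simp add: field_simps)
  qed
  then show thesis using that[of "inverse C"] C by simp
qed

lemma bounded_linear_inv:
  fixes f :: "'a::banach \<Rightarrow> 'a"
  assumes f: "bounded_linear f" and bij: "bij f"
  shows "bounded_linear (inv f)"
proof -
  obtain c where c: "c > 0" "\<And>x. c * norm x \<le> norm (f x)"
    using bij_bounded_linear_bounded_below[OF f bij] by blast
  have lin: "linear (inv f)"
    using linear_inv_bij[OF bounded_linear.linear[OF f] bij] .
  show ?thesis
  proof (rule bounded_linear_intro[of _ "inverse c"])
    show "norm (inv f x) \<le> norm x * inverse c" for x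
      using c(2)[of "inv f x"] c(1) bij by (simp add: bij_is_surj surj_f_inv_f field_simps)
  qed (use linear_add[OF lin] linear_scale[OF lin] in auto)
qed

text \<open>Subtracting \<open>g\<close> costs at most half of the lower bound. The equation
  \<open>f x - g x = y\<close> is the fixed point equation \<open>inv f (y + g x) = x\<close>, whose
  left side contracts by 1/2.\<close>

lemma bij_bounded_below_perturb:
  fixes f g :: "'a::banach \<Rightarrow> 'a"
  assumes f: "linear f" "bij f" and c: "c > 0" "\<And>x. c * norm x \<le> norm (f x)"
    and g: "linear g" "\<And>x. norm (g x) \<le> c / 2 * norm x"
  shows "c / 2 * norm x \<le> norm (f x - g x)" "bij (\<lambda>x. f x - g x)"
proof -
  show below: "c / 2 * norm x \<le> norm (f x - g x)" for x
    using norm_triangle_ineq2[of "f x" "g x"] c(2)[of x] g(2)[of x] by simp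
  have finv: "f (inv f y) = y" for y
    using f(2) by (simp add: bij_is_surj surj_f_inv_f)
  show "bij (\<lambda>x. f x - g x)"
  proof (rule bijI)
    show "inj (\<lambda>x. f x - g x)"
    proof (rule injI)
      fix x y assume "f x - g x = f y - g y"
      then have "f (x - y) - g (x - y) = 0"
        by (simp add: linear_diff[OF f(1)] linear_diff[OF g(1)] algebra_simps)
      then have "c / 2 * norm (x - y) \<le> 0" using below[of "x - y"] by simp
      then show "x = y" using c(1) by (simp add: mult_le_0_iff)
    qed
    show "surj (\<lambda>x. f x - g x)"
      unfolding surj_def
    proof
      fix y
      have "\<exists>!x. inv f (y + g x) = x"
      proof (rule banach_fix_type[of "1/2"])
        have "dist (inv f (y + g u)) (inv f (y + g v)) \<le> 1 / 2 * dist u v" for u v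
        proof -
          have "f (inv f (y + g u) - inv f (y + g v)) = g (u - v)"
            by (simp add: linear_diff[OF f(1)] linear_diff[OF g(1)] finv)
          then have "c * norm (inv f (y + g u) - inv f (y + g v)) \<le> c / 2 * norm (u - v)"
            using c(2)[of "inv f (y + g u) - inv f (y + g v)"] g(2)[of "u - v"] by simp
          then show ?thesis using c(1) by (simp add: dist_norm)
        qed
        then show "\<forall>u v. dist (inv f (y + g u)) (inv f (y + g v)) \<le> 1 / 2 * dist u v" by blast
      qed auto
      then obtain x where "inv f (y + g x) = x" by blast
      then have "y + g x = f x" by (metis finv)
      then show "\<exists>x. y = f x - g x" by (metis add_diff_cancel_right')
    qed
  qed
qed

section \<open>Averages over roots of unity\<close>

text \<open>Orders that are powers of 2 make the roots of consecutive stages nested, so that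
  averages can be compared by doubling.\<close>

definition unity_root :: "nat \<Rightarrow> complex" where
  "unity_root k = cis (2 * pi / 2 ^ k)"

lemma norm_unity_root [simp]: "cmod (unity_root k) = 1"
  by (simp add: unity_root_def)

lemma unity_root_power: "unity_root k ^ n = cis (2 * pi * real n / 2 ^ k)"
  unfolding unity_root_def Complex.DeMoivre by (simp add: mult_ac)

lemma unity_root_power_period: "unity_root k ^ (2 ^ k) = 1"
  by (simp add: unity_root_power)

lemma unity_root_Suc_sq: "unity_root (Suc k) ^ 2 = unity_root k"
  by (simp add: unity_root_power) (simp add: unity_root_def field_simps)

lemma unity_root_power_neq_1:
  assumes "0 < n" "n < 2 ^ k"
  shows "unity_root k ^ n \<noteq> 1"
proof -
  have "unity_root k ^ n = exp (2 * of_real pi * \<i> * of_nat n / of_nat (2 ^ k))"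
    by (simp add: unity_root_power cis_conv_exp mult_ac)
  moreover have "\<not> 2 ^ k dvd n" using assms by (simp add: nat_dvd_not_less)
  ultimately show ?thesis using complex_root_unity_eq_1[of "2 ^ k" n] by simp
qed

text \<open>A chord is twice the sine of half the angle, hence at most the angle.\<close>

lemma norm_unity_root_minus_1: "cmod (unity_root k - 1) \<le> 2 * pi * (1 / 2) ^ k"
proof -
  have "cmod (unity_root k - 1) = 2 * \<bar>sin (pi / 2 ^ k)\<bar>"
    using dist_exp_i_1[of "2 * pi / 2 ^ k"] by (simp add: unity_root_def cis_conv_exp)
  also have "\<dots> \<le> 2 * \<bar>pi / 2 ^ k\<bar>"
    using abs_sin_x_le_abs_x[of "pi / 2 ^ k"] by simp
  finally show ?thesis by (simp add: power_divide)
qed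

definition circle_avg :: "nat \<Rightarrow> (complex \<Rightarrow> 'b::real_vector) \<Rightarrow> 'b" where
  "circle_avg k h = (\<Sum>j<2 ^ k. h (unity_root k ^ j)) /\<^sub>R 2 ^ k"

lemma circle_avg_cong:
  assumes "\<And>u. cmod u = 1 \<Longrightarrow> h u = g u"
  shows "circle_avg k h = circle_avg k g"
  unfolding circle_avg_def by (simp add: assms norm_power)

lemma circle_avg_linear:
  assumes "linear f"
  shows "f (circle_avg k h) = circle_avg k (\<lambda>u. f (h u))"
  by (simp add: circle_avg_def linear_scale[OF assms] linear_sum[OF assms])

lemma circle_avg_add: "circle_avg k (\<lambda>u. h u + g u) = circle_avg k h + circle_avg k g"
  by (simp add: circle_avg_def sum.distrib scaleR_add_right)

lemma circle_avg_diff: "circle_avg k (\<lambda>u. h u - g u) = circle_avg k h - circle_avg k g"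
  by (simp add: circle_avg_def sum_subtractf scaleR_diff_right)

lemma circle_avg_sum: "circle_avg k (\<lambda>u. \<Sum>i\<in>I. h i u) = (\<Sum>i\<in>I. circle_avg k (h i))"
  unfolding circle_avg_def by (subst sum.swap) (simp add: scaleR_sum_right)

lemma circle_avg_const [simp]: "circle_avg k (\<lambda>_. x) = x"
  by (simp add: circle_avg_def sum_constant_scaleR)

lemma circle_avg_norm:
  fixes h :: "complex \<Rightarrow> 'b::real_normed_vector"
  assumes "\<And>u. cmod u = 1 \<Longrightarrow> norm (h u) \<le> B"
  shows "norm (circle_avg k h) \<le> B"
proof -
  have "norm (\<Sum>j<2 ^ k. h (unity_root k ^ j)) \<le> (\<Sum>j<(2::nat) ^ k. B)"
    by (rule sum_norm_le) (simp add: assms norm_power)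
  then show ?thesis by (simp add: circle_avg_def field_simps)
qed

text \<open>Rotation shifts the exponents by one, and periodicity identifies the two end
  terms.\<close>

lemma circle_avg_rotate: "circle_avg k (\<lambda>u. h (unity_root k * u)) = circle_avg k h"
proof -
  have "(\<Sum>j<2 ^ k. h (unity_root k ^ Suc j)) + h (unity_root k ^ 0)
      = (\<Sum>j<2 ^ k. h (unity_root k ^ j)) + h (unity_root k ^ (2 ^ k))"
    using sum.lessThan_Suc_shift[of "\<lambda>j. h (unity_root k ^ j)" "2 ^ k"]
      sum.lessThan_Suc[of "\<lambda>j. h (unity_root k ^ j)" "2 ^ k"] by (simp add: add.commute)
  then show ?thesis by (simp add: circle_avg_def unity_root_power_period)
qed

lemma sum_lessThan_double:
  fixes f :: "nat \<Rightarrow> 'b::comm_monoid_add"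
  shows "(\<Sum>j<2 * n. f j) = (\<Sum>j<n. f (2 * j)) + (\<Sum>j<n. f (2 * j + 1))"
  by (induction n) (simp_all add: add_ac)

text \<open>Even powers of the finer root are the coarser roots; odd powers are these turned by the
  finer root.\<close>

lemma circle_avg_Suc:
  "circle_avg (Suc k) h
    = (circle_avg k h + circle_avg k (\<lambda>u. h (unity_root (Suc k) * u))) /\<^sub>R 2"
proof -
  have "unity_root (Suc k) ^ (2 * j) = unity_root k ^ j" for j
    by (simp add: power_mult unity_root_Suc_sq)
  then show ?thesis
    by (simp add: circle_avg_def sum_lessThan_double scaleR_add_right)
qed

text \<open>Rotation leaves the average unchanged but also multiplies it by
  \<open>unity_root k ^ n\<close>, which is not 1. The average vanishes exactly, at a finite
  stage.\<close>

lemma circle_avg_power: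
  fixes x :: "'b::complex_normed_vector"
  assumes "0 < n" "n < 2 ^ k"
  shows "circle_avg k (\<lambda>u. u ^ n *\<^sub>C x) = 0"
proof -
  have "circle_avg k (\<lambda>u. u ^ n *\<^sub>C x) = circle_avg k (\<lambda>u. (unity_root k * u) ^ n *\<^sub>C x)"
    using circle_avg_rotate[of k "\<lambda>u. u ^ n *\<^sub>C x"] by simp
  also have "\<dots> = circle_avg k (\<lambda>u. unity_root k ^ n *\<^sub>C u ^ n *\<^sub>C x)"
    by (simp add: power_mult_distrib scaleC_scaleC)
  also have "\<dots> = unity_root k ^ n *\<^sub>C circle_avg k (\<lambda>u. u ^ n *\<^sub>C x)"
    by (rule circle_avg_linear[symmetric]) (rule bounded_linear.linear[OF bounded_linear_scaleC])
  finally have "(unity_root k ^ n - 1) *\<^sub>C circle_avg k (\<lambda>u. u ^ n *\<^sub>C x) = 0"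
    by (simp add: scaleC_diff_left)
  then show ?thesis
    using unity_root_power_neq_1[OF assms] by (simp add: scaleC_eq_0_iff)
qed

lemma circle_avg_inverse_power:
  fixes x :: "'b::complex_normed_vector"
  assumes "0 < n" "n < 2 ^ k"
  shows "circle_avg k (\<lambda>u. inverse u ^ n *\<^sub>C x) = 0"
proof -
  have "circle_avg k (\<lambda>u. inverse u ^ n *\<^sub>C x)
      = circle_avg k (\<lambda>u. inverse (unity_root k * u) ^ n *\<^sub>C x)"
    using circle_avg_rotate[of k "\<lambda>u. inverse u ^ n *\<^sub>C x"] by simp
  also have "\<dots> = circle_avg k (\<lambda>u. inverse (unity_root k) ^ n *\<^sub>C inverse u ^ n *\<^sub>C x)"
    by (simp add: power_mult_distrib scaleC_scaleC)
  also have "\<dots> = inverse (unity_root k) ^ n *\<^sub>C circle_avg k (\<lambda>u. inverse u ^ n *\<^sub>C x)"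
    by (rule circle_avg_linear[symmetric]) (rule bounded_linear.linear[OF bounded_linear_scaleC])
  finally have "(inverse (unity_root k) ^ n - 1) *\<^sub>C circle_avg k (\<lambda>u. inverse u ^ n *\<^sub>C x) = 0"
    by (simp add: scaleC_diff_left)
  then show ?thesis
    using unity_root_power_neq_1[OF assms] by (simp add: scaleC_eq_0_iff power_inverse)
qed

text \<open>By the doubling formula consecutive averages differ by half the average change of
  \<open>h\<close> under rotation by the finer root. This is of order \<open>(1 / 2) ^ k\<close>,
  hence summable.\<close>

lemma circle_avg_convergent:
  fixes h :: "complex \<Rightarrow> 'b::banach"
  assumes lip: "\<And>u v. cmod u = 1 \<Longrightarrow> cmod v = 1 \<Longrightarrow> norm (h u - h v) \<le> L * cmod (u - v)"
  shows "convergent (\<lambda>k. circle_avg k h)"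
proof -
  \<comment> \<open>Testing the bound on the points 1 and -1 shows that \<open>L\<close> is not
    negative.\<close>
  have "0 \<le> L * cmod (1 - - 1)" by (rule order_trans[OF norm_ge_zero lip]) simp_all
  then have L: "L \<ge> 0" by (simp add: zero_le_mult_iff)
  define D where "D k = circle_avg (Suc k) h - circle_avg k h" for k
  have D: "norm (D k) \<le> L * pi * (1 / 2) ^ k" for k
  proof -
    have "D k = (circle_avg k (\<lambda>u. h (unity_root (Suc k) * u)) - circle_avg k h) /\<^sub>R 2"
      unfolding D_def circle_avg_Suc
      by (rule scaleR_left_imp_eq[of 2]) (simp_all add: scaleR_diff_right scaleR_2)
    also have "\<dots> = circle_avg k (\<lambda>u. h (unity_root (Suc k) * u) - h u) /\<^sub>R 2"
      by (simp add: circle_avg_diff)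
    finally have "norm (D k) = norm (circle_avg k (\<lambda>u. h (unity_root (Suc k) * u) - h u)) / 2"
      by simp
    also have "norm (circle_avg k (\<lambda>u. h (unity_root (Suc k) * u) - h u)) \<le> L * (2 * pi * (1 / 2) ^ Suc k)"
    proof (rule circle_avg_norm)
      fix u assume u: "cmod u = 1"
      have "norm (h (unity_root (Suc k) * u) - h u) \<le> L * cmod (unity_root (Suc k) * u - u)"
        using u by (intro lip) (simp_all add: norm_mult)
      also have "unity_root (Suc k) * u - u = (unity_root (Suc k) - 1) * u"
        by (simp add: algebra_simps)
      also have "L * cmod \<dots> \<le> L * (2 * pi * (1 / 2) ^ Suc k)"
        using u L norm_unity_root_minus_1[of "Suc k"] by (intro mult_left_mono) (simp_all add: norm_mult)
      finally show "norm (h (unity_root (Suc k) * u) - h u) \<le> L * (2 * pi * (1 / 2) ^ Suc k)" .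
    qed
    also have "L * (2 * pi * (1 / 2) ^ Suc k) / 2 \<le> L * pi * (1 / 2) ^ k"
      using L by (simp add: field_simps mult_right_mono)
    finally show ?thesis by simp
  qed
  have "summable (\<lambda>k. L * pi * (1 / 2 :: real) ^ k)"
    by (intro summable_mult summable_geometric) simp
  then have "summable D"
    by (rule summable_comparison_test'[of _ 0]) (rule D)
  then have "(\<lambda>n. circle_avg 0 h + (\<Sum>k<n. D k)) \<longlonglongrightarrow> circle_avg 0 h + suminf D"
    by (intro tendsto_intros summable_LIMSEQ)
  moreover have "circle_avg 0 h + (\<Sum>k<n. D k) = circle_avg n h" for n
    unfolding D_def by (subst sum_lessThan_telescope) simp
  ultimately show ?thesis by (auto simp: convergent_def)
qed

definition circle_mean :: "(complex \<Rightarrow> 'b::real_normed_vector) \<Rightarrow> 'b" where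
  "circle_mean h = lim (\<lambda>k. circle_avg k h)"

lemma circle_mean_LIMSEQ:
  "convergent (\<lambda>k. circle_avg k h) \<Longrightarrow> (\<lambda>k. circle_avg k h) \<longlonglongrightarrow> circle_mean h"
  by (simp add: circle_mean_def convergent_LIMSEQ_iff)

text \<open>Because \<open>h\<close> is complex differentiable, rotating by the generating root of unity moves it,
  to first order, in the same direction \<open>d\<close> as a radial dilation does. Rotation leaves the average
  unchanged, so the average of \<open>d\<close> tends to 0 and the dilation has no first order effect
  on the mean.\<close>

lemma circle_mean_dilation:
  fixes h :: "complex \<Rightarrow> 'b::complex_normed_vector"
  assumes rot: "\<And>u t. cmod u = 1 \<Longrightarrow> cmod t = 1 \<Longrightarrow>
      norm (h (t * u) - h u - (t - 1) *\<^sub>C d u) \<le> L * (cmod (t - 1))\<^sup>2"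
    and dil: "\<And>u. cmod u = 1 \<Longrightarrow> norm (h (t * u) - h u - (t - 1) *\<^sub>C d u) \<le> L * (cmod (t - 1))\<^sup>2"
    and conv: "convergent (\<lambda>k. circle_avg k h)" "convergent (\<lambda>k. circle_avg k (\<lambda>u. h (t * u)))"
  shows "norm (circle_mean (\<lambda>u. h (t * u)) - circle_mean h) \<le> L * (cmod (t - 1))\<^sup>2"
proof -
  have lin: "linear (\<lambda>x::'b. s *\<^sub>C x)" for s
    by (rule bounded_linear.linear[OF bounded_linear_scaleC])
  have avg: "circle_avg k (\<lambda>u. h (s * u) - h u - (s - 1) *\<^sub>C d u)
      = circle_avg k (\<lambda>u. h (s * u)) - circle_avg k h - (s - 1) *\<^sub>C circle_avg k d" for s k
    by (simp add: circle_avg_diff circle_avg_linear[OF lin])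
  have d: "norm (circle_avg (Suc k) d) \<le> L * cmod (unity_root (Suc k) - 1)" for k
  proof -
    define e where "e = unity_root (Suc k)"
    \<comment> \<open>This is why the stage is \<open>Suc k\<close>: the root of stage 0 is 1, and
      the estimate gets divided by \<open>cmod (e - 1)\<close>.\<close>
    have "e \<noteq> 1"
      using unity_root_power_neq_1[of 1 "Suc k"] one_less_power[of "2::nat" "Suc k"] by (simp add: e_def)
    have "norm (circle_avg (Suc k) (\<lambda>u. h (e * u) - h u - (e - 1) *\<^sub>C d u)) \<le> L * (cmod (e - 1))\<^sup>2"
      by (rule circle_avg_norm) (simp add: rot e_def)
    then have "cmod (e - 1) * norm (circle_avg (Suc k) d) \<le> cmod (e - 1) * (L * cmod (e - 1))"
      unfolding avg e_def circle_avg_rotate by (simp add: norm_scaleC power2_eq_square mult_ac)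
    then show ?thesis using \<open>e \<noteq> 1\<close> by (simp add: e_def)
  qed
  have "(\<lambda>k. 2 * pi * (1 / 2) ^ Suc k) \<longlonglongrightarrow> (0::real)"
    by (intro tendsto_mult_right_zero LIMSEQ_Suc LIMSEQ_power_zero) simp
  then have "(\<lambda>k. cmod (unity_root (Suc k) - 1)) \<longlonglongrightarrow> 0"
    by (rule Lim_null_comparison[rotated]) (use norm_unity_root_minus_1[of "Suc k" for k] in simp)
  then have "(\<lambda>k. L * cmod (unity_root (Suc k) - 1)) \<longlonglongrightarrow> 0"
    by (rule tendsto_mult_right_zero)
  then have "(\<lambda>k. circle_avg (Suc k) d) \<longlonglongrightarrow> 0"
    by (rule Lim_null_comparison[rotated]) (simp add: d)
  then have d0: "(\<lambda>k. (t - 1) *\<^sub>C circle_avg (Suc k) d) \<longlonglongrightarrow> (t - 1) *\<^sub>C 0"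
    by (rule bounded_linear.tendsto[OF bounded_linear_scaleC])
  have "(\<lambda>k. norm (circle_avg (Suc k) (\<lambda>u. h (t * u) - h u - (t - 1) *\<^sub>C d u)))
      \<longlonglongrightarrow> norm (circle_mean (\<lambda>u. h (t * u)) - circle_mean h - (t - 1) *\<^sub>C 0)"
    unfolding avg
    by (intro tendsto_norm tendsto_diff d0 LIMSEQ_Suc circle_mean_LIMSEQ conv)
  then have "norm (circle_mean (\<lambda>u. h (t * u)) - circle_mean h - (t - 1) *\<^sub>C 0) \<le> L * (cmod (t - 1))\<^sup>2"
    by (rule LIMSEQ_le_const2) (auto intro!: circle_avg_norm dil)
  then show ?thesis by simp
qed

text \<open>Quadratic increments force the derivative to be 0 throughout the convex set.\<close>

lemma constant_if_quadratic_increments: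
  fixes f :: "real \<Rightarrow> 'b::real_normed_vector"
  assumes S: "convex S" and inc: "\<And>x y. x \<in> S \<Longrightarrow> y \<in> S \<Longrightarrow> norm (f y - f x) \<le> C * (y - x)\<^sup>2"
    and xy: "x \<in> S" "y \<in> S"
  shows "f x = f y"
proof -
  have "(f has_derivative (\<lambda>h. 0)) (at x within S)" if x: "x \<in> S" for x
    unfolding has_derivative_within_alt
  proof (intro conjI allI impI)
    fix e :: real assume e: "0 < e"
    define d where "d = e / (\<bar>C\<bar> + 1)"
    have d: "d > 0" using e by (simp add: d_def)
    have "norm (f y - f x - 0) \<le> e * norm (y - x)" if y: "y \<in> S" "norm (y - x) < d" for y
    proof -
      have "norm (f y - f x - 0) \<le> C * (y - x)\<^sup>2" using inc[OF x y(1)] by simp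
      also have "\<dots> \<le> (\<bar>C\<bar> + 1) * (y - x)\<^sup>2" by (intro mult_right_mono) auto
      also have "\<dots> = (\<bar>C\<bar> + 1) * \<bar>y - x\<bar> * \<bar>y - x\<bar>" by (simp add: power2_eq_square)
      also have "\<dots> \<le> (\<bar>C\<bar> + 1) * d * \<bar>y - x\<bar>"
        using y(2) by (intro mult_right_mono mult_left_mono) auto
      also have "\<dots> = e * norm (y - x)" by (simp add: d_def)
      finally show ?thesis .
    qed
    then show "\<exists>d>0. \<forall>y\<in>S. norm (y - x) < d \<longrightarrow> norm (f y - f x - 0) \<le> e * norm (y - x)"
      using d by blast
  qed simp
  then show ?thesis using has_derivative_zero_constant[OF S] xy by metis
qed

section \<open>The Riesz projection\<close>

text \<open>\<open>G w\<close> is the inverse of \<open>1 - w T\<close>, that is, the resolvent of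
  \<open>T\<close> at \<open>1 / w\<close> divided by \<open>w\<close>, bounded uniformly on an
  annulus around the unit circle.\<close>

locale annular_resolvent =
  fixes T :: "'b::complex_banach \<Rightarrow> 'b" and G :: "complex \<Rightarrow> 'b \<Rightarrow> 'b" and K M a b :: real
  assumes T: "bounded_clinear T" and bij: "bij T"
    and K: "0 < K" "\<And>x. norm (T x) \<le> K * norm x"
    and ab: "0 < a" "a < 1" "1 < b"
    and M: "0 < M"
    and G_right: "\<And>w x. a \<le> cmod w \<Longrightarrow> cmod w \<le> b \<Longrightarrow> G w x - w *\<^sub>C T (G w x) = x"
    and G_left: "\<And>w x. a \<le> cmod w \<Longrightarrow> cmod w \<le> b \<Longrightarrow> G w (x - w *\<^sub>C T x) = x"
    and G_norm: "\<And>w x. a \<le> cmod w \<Longrightarrow> cmod w \<le> b \<Longrightarrow> norm (G w x) \<le> M * norm x"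
begin

definition A :: "complex set" where
  "A = {w. a \<le> cmod w \<and> cmod w \<le> b}"

lemma G_AD:
  assumes "w \<in> A"
  shows "G w x - w *\<^sub>C T (G w x) = x" "G w (x - w *\<^sub>C T x) = x" "norm (G w x) \<le> M * norm x"
  using assms G_right G_left G_norm by (auto simp: A_def)

lemma A_nonzero: "w \<in> A \<Longrightarrow> w \<noteq> 0"
  using ab by (auto simp: A_def)

lemma A_of_real: "r \<in> {a..b} \<Longrightarrow> cmod u = 1 \<Longrightarrow> of_real r * u \<in> A"
  using ab by (auto simp: A_def norm_mult)

lemma bl: "bounded_linear T" and T_scaleC: "T (c *\<^sub>C x) = c *\<^sub>C T x"
  using T by (auto simp: bounded_clinear_def)

lemma lin: "linear T" "linear (inv T)" "linear (T ^^ n)" "linear (inv T ^^ n)"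
  using bl bij linear_inv_bij linear_funpow bounded_linear.linear by blast+

lemma lin_scaleC: "linear (\<lambda>x::'b. c *\<^sub>C x)"
  by (rule bounded_linear.linear[OF bounded_linear_scaleC])

lemma inv_simps [simp]: "inv T (T x) = x" "T (inv T x) = x"
  using bij by (simp_all add: bij_is_inj bij_is_surj surj_f_inv_f)

lemma inv_scaleC: "inv T (c *\<^sub>C x) = c *\<^sub>C inv T x"
  by (metis T_scaleC inv_simps)

lemma G_eqI: "w \<in> A \<Longrightarrow> y - w *\<^sub>C T y = x \<Longrightarrow> G w x = y"
  using G_AD(2) by blast

lemma G_T:
  assumes w: "w \<in> A"
  shows "G w (T x) = T (G w x)"
proof (rule G_eqI[OF w])
  have "T (G w x) - w *\<^sub>C T (T (G w x)) = T (G w x - w *\<^sub>C T (G w x))"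
    by (simp add: linear_diff[OF lin(1)] T_scaleC)
  then show "T (G w x) - w *\<^sub>C T (T (G w x)) = T x" by (simp add: G_AD(1)[OF w])
qed

lemma T_G:
  assumes w: "w \<in> A"
  shows "T (G w x) = inverse w *\<^sub>C (G w x - x)"
proof -
  have "G w x - x = w *\<^sub>C T (G w x)"
    using G_AD(1)[OF w, of x] by (metis diff_diff_eq2 add_diff_cancel_left')
  then show ?thesis using A_nonzero[OF w] by (simp add: scaleC_scaleC)
qed

text \<open>With \<open>y = G z x\<close>, the vector \<open>x\<close> is \<open>y - w T y\<close>
  plus \<open>(w - z) T y\<close>. This suggests \<open>y + (w - z) G w (T y)\<close> for
  \<open>G w x\<close>, which is checked against the equation that determines it.\<close>

lemma resolvent_identity:
  assumes w: "w \<in> A" and z: "z \<in> A"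
  shows "G w x - G z x = (w - z) *\<^sub>C T (G w (G z x))"
proof -
  define y where "y = G z x"
  define u where "u = G w (T y)"
  have y: "y - z *\<^sub>C T y = x" and u: "u - w *\<^sub>C T u = T y"
    using G_AD(1)[OF z] G_AD(1)[OF w] by (simp_all add: y_def u_def)
  have "G w x = y + (w - z) *\<^sub>C u"
  proof (rule G_eqI[OF w])
    have "y + (w - z) *\<^sub>C u - w *\<^sub>C T (y + (w - z) *\<^sub>C u)
        = y - w *\<^sub>C T y + (w - z) *\<^sub>C (u - w *\<^sub>C T u)"
      by (simp add: linear_add[OF lin(1)] T_scaleC scaleC_add_right scaleC_diff_right scaleC_scaleC
          mult.commute)
    also have "\<dots> = y - z *\<^sub>C T y"
      unfolding u by (simp add: scaleC_diff_left)
    finally show "y + (w - z) *\<^sub>C u - w *\<^sub>C T (y + (w - z) *\<^sub>C u) = x" using y by simp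
  qed
  then show ?thesis by (simp add: y_def u_def G_T[OF w])
qed

lemma T_G_G_norm:
  assumes "w \<in> A" "z \<in> A"
  shows "norm (T (G w (G z x))) \<le> K * M\<^sup>2 * norm x"
proof -
  have "norm (T (G w (G z x))) \<le> K * norm (G w (G z x))" by (rule K(2))
  also have "\<dots> \<le> K * (M * norm (G z x))"
    using K(1) G_AD(3)[OF assms(1)] by (intro mult_left_mono) auto
  also have "\<dots> \<le> K * (M * (M * norm x))"
    using K(1) M G_AD(3)[OF assms(2)] by (intro mult_left_mono) auto
  finally show ?thesis by (simp add: power2_eq_square mult_ac)
qed

lemma G_lipschitz:
  assumes "w \<in> A" "z \<in> A"
  shows "norm (G w x - G z x) \<le> K * M\<^sup>2 * norm x * cmod (w - z)"
  using mult_left_mono[OF T_G_G_norm[OF assms, of x], of "cmod (w - z)"]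
  by (simp add: resolvent_identity[OF assms] norm_scaleC mult_ac)

text \<open>\<open>T (G z (G z x))\<close> is the complex derivative of \<open>G\<close> at
  \<open>z\<close>. The resolvent identity leaves \<open>w - z\<close> times a difference of values
  of \<open>G\<close>, and the Lipschitz bound supplies the second factor.\<close>

lemma G_second_order:
  assumes w: "w \<in> A" and z: "z \<in> A"
  shows "norm (G w x - G z x - (w - z) *\<^sub>C T (G z (G z x)))
    \<le> K\<^sup>2 * M ^ 3 * norm x * (cmod (w - z))\<^sup>2"
proof -
  define y where "y = G z x"
  have "G w x - G z x - (w - z) *\<^sub>C T (G z (G z x)) = (w - z) *\<^sub>C T (G w y - G z y)"
    unfolding resolvent_identity[OF w z, of x]
    by (simp add: y_def linear_diff[OF lin(1)] scaleC_diff_right)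
  then have "norm (G w x - G z x - (w - z) *\<^sub>C T (G z (G z x)))
      = cmod (w - z) * norm (T (G w y - G z y))"
    by (simp add: norm_scaleC)
  also have "\<dots> \<le> cmod (w - z) * (K * norm (G w y - G z y))"
    by (intro mult_left_mono K(2)) simp
  also have "\<dots> \<le> cmod (w - z) * (K * (K * M\<^sup>2 * norm y * cmod (w - z)))"
    using K(1) by (intro mult_left_mono G_lipschitz w z) auto
  also have "\<dots> \<le> cmod (w - z) * (K * (K * M\<^sup>2 * (M * norm x) * cmod (w - z)))"
    unfolding y_def using K(1) M by (intro mult_left_mono mult_right_mono G_AD(3)[OF z]) auto
  finally show ?thesis by (simp add: power2_eq_square power3_eq_cube mult_ac)
qed

text \<open>Substituting \<open>z = 1 / w\<close> gives the contour integral of the resolvent over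
  the circle of radius \<open>1 / r\<close>: the Riesz projection for the spectrum inside
  it.\<close>

definition mean :: "real \<Rightarrow> 'b \<Rightarrow> 'b" where
  "mean r x = circle_mean (\<lambda>u. G (of_real r * u) x)"

lemma G_avg_convergent:
  assumes r: "r \<in> {a..b}"
  shows "convergent (\<lambda>k. circle_avg k (\<lambda>u. G (of_real r * u) x))"
proof (rule circle_avg_convergent)
  fix u v assume uv: "cmod u = 1" "cmod v = 1"
  have "cmod (of_real r * u - of_real r * v) = r * cmod (u - v)"
    using r ab by (simp flip: right_diff_distrib add: norm_mult)
  then show "norm (G (of_real r * u) x - G (of_real r * v) x) \<le> (K * M\<^sup>2 * norm x * r) * cmod (u - v)"
    using G_lipschitz[OF A_of_real[OF r uv(1)] A_of_real[OF r uv(2)], of x] by (simp add: mult_ac)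
qed

lemma mean_LIMSEQ:
  assumes "r \<in> {a..b}"
  shows "(\<lambda>k. circle_avg k (\<lambda>u. G (of_real r * u) x)) \<longlonglongrightarrow> mean r x"
  unfolding mean_def by (rule circle_mean_LIMSEQ[OF G_avg_convergent[OF assms]])

lemma mean_increment:
  assumes r: "r \<in> {a..b}" and s: "s \<in> {a..b}"
  shows "norm (mean r x - mean s x) \<le> K\<^sup>2 * M ^ 3 * norm x * (r - s)\<^sup>2"
proof -
  have s0: "s > 0" using s ab by auto
  \<comment> \<open>Dilation by \<open>t\<close> takes the circle of radius \<open>s\<close> to that
    of radius \<open>r\<close>. \<open>d u\<close> is the derivative of \<open>h (c * u)\<close> in
    \<open>c\<close> at 1, and the factor \<open>s * s\<close> in \<open>L\<close> turns
    \<open>t - 1\<close> into \<open>r - s\<close>.\<close>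
  define t where "t = complex_of_real (r / s)"
  define h where "h u = G (of_real s * u) x" for u
  define d where "d u = (of_real s * u) *\<^sub>C T (G (of_real s * u) (G (of_real s * u) x))" for u
  define L where "L = K\<^sup>2 * M ^ 3 * norm x * s\<^sup>2"
  have est: "norm (h (c * u) - h u - (c - 1) *\<^sub>C d u) \<le> L * (cmod (c - 1))\<^sup>2"
    if u: "cmod u = 1" and c: "of_real s * (c * u) \<in> A" for u c
  proof -
    have eq: "of_real s * (c * u) - of_real s * u = (c - 1) * (of_real s * u)"
      by (simp add: algebra_simps)
    have "(cmod ((c - 1) * (of_real s * u)))\<^sup>2 = s\<^sup>2 * (cmod (c - 1))\<^sup>2"
      using u by (simp add: norm_mult power_mult_distrib)
    then show ?thesis
      using G_second_order[OF c A_of_real[OF s u], of x]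
      unfolding eq h_def d_def L_def by (simp add: scaleC_scaleC mult_ac)
  qed
  have ht: "h (t * u) = G (of_real r * u) x" for u
    using s0 by (simp add: h_def t_def)
  have "norm (circle_mean (\<lambda>u. h (t * u)) - circle_mean h) \<le> L * (cmod (t - 1))\<^sup>2"
  proof (rule circle_mean_dilation)
    show "norm (h (c * u) - h u - (c - 1) *\<^sub>C d u) \<le> L * (cmod (c - 1))\<^sup>2"
      if "cmod u = 1" "cmod c = 1" for u c
      using that by (intro est A_of_real[OF s]) (simp_all add: norm_mult)
    show "norm (h (t * u) - h u - (t - 1) *\<^sub>C d u) \<le> L * (cmod (t - 1))\<^sup>2"
      if "cmod u = 1" for u
      using A_of_real[OF r that] s0 by (intro est that) (simp add: t_def)
    show "convergent (\<lambda>k. circle_avg k h)"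
      unfolding h_def by (rule G_avg_convergent[OF s])
    show "convergent (\<lambda>k. circle_avg k (\<lambda>u. h (t * u)))"
      unfolding ht by (rule G_avg_convergent[OF r])
  qed
  moreover have "t - 1 = of_real (r / s - 1)" by (simp add: t_def)
  then have "cmod (t - 1) = \<bar>r / s - 1\<bar>" by (simp only: norm_of_real)
  then have "s\<^sup>2 * (cmod (t - 1))\<^sup>2 = (r - s)\<^sup>2"
    using s0 by (simp flip: power_mult_distrib add: right_diff_distrib)
  ultimately show ?thesis
    unfolding ht unfolding h_def mean_def[symmetric] L_def by (simp add: mult_ac)
qed

lemma mean_indep:
  assumes "r \<in> {a..b}" "s \<in> {a..b}"
  shows "mean r x = mean s x"
  by (rule constant_if_quadratic_increments[of "{a..b}" "\<lambda>r. mean r x"])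
    (use assms mean_increment in auto)

text \<open>Iteration of \<open>T_G\<close>. The correction terms carry powers of
  \<open>inverse v\<close> with exponents from 1 to \<open>n\<close>, which averages over more than
  \<open>n\<close> roots remove.\<close>

lemma funpow_G:
  assumes v: "v \<in> A"
  shows "(T ^^ n) (G v x) = inverse v ^ n *\<^sub>C G v x - (\<Sum>m<n. inverse v ^ (n - m) *\<^sub>C (T ^^ m) x)"
proof (induction n)
  case (Suc n)
  have "(T ^^ Suc n) (G v x) = inverse v ^ n *\<^sub>C T (G v x)
      - (\<Sum>m<n. inverse v ^ (n - m) *\<^sub>C (T ^^ Suc m) x)"
    by (simp add: Suc linear_diff[OF lin(1)] linear_sum[OF lin(1)] T_scaleC)
  also have "inverse v ^ n *\<^sub>C T (G v x) = inverse v ^ Suc n *\<^sub>C G v x - inverse v ^ Suc n *\<^sub>C x"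
    unfolding T_G[OF v] by (simp add: scaleC_scaleC scaleC_diff_right mult.commute)
  also have "\<dots> - (\<Sum>m<n. inverse v ^ (n - m) *\<^sub>C (T ^^ Suc m) x)
      = inverse v ^ Suc n *\<^sub>C G v x - (\<Sum>m<Suc n. inverse v ^ (Suc n - m) *\<^sub>C (T ^^ m) x)"
    by (subst sum.lessThan_Suc_shift) simp
  finally show ?case .
qed simp

text \<open>\<open>G v x - x = v T (G v x)\<close> makes the first inverse step exact, so the count
  starts at \<open>Suc n\<close>. The corrections again carry exponents from 1 to \<open>n\<close>,
  now of \<open>v\<close>.\<close>

lemma inv_funpow_G:
  assumes v: "v \<in> A"
  shows "(inv T ^^ Suc n) (G v x - x)
    = v ^ Suc n *\<^sub>C G v x + (\<Sum>m<n. v ^ Suc m *\<^sub>C (inv T ^^ (n - m)) x)"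
proof (induction n)
  case 0
  have "G v x - x = v *\<^sub>C T (G v x)"
    unfolding T_G[OF v] using A_nonzero[OF v] by (simp add: scaleC_scaleC)
  then show ?case by (simp add: inv_scaleC)
next
  case (Suc n)
  have "G v x = x + v *\<^sub>C T (G v x)"
    using G_AD(1)[OF v, of x] by (simp add: algebra_simps)
  then have G: "inv T (G v x) = inv T x + v *\<^sub>C G v x"
    by (metis inv_scaleC inv_simps(1) linear_add[OF lin(2)])
  have "(inv T ^^ Suc (Suc n)) (G v x - x)
      = v ^ Suc n *\<^sub>C inv T (G v x) + (\<Sum>m<n. v ^ Suc m *\<^sub>C inv T ((inv T ^^ (n - m)) x))"
    unfolding funpow.simps(2)[of "Suc n"] o_apply Suc
    by (simp only: linear_add[OF lin(2)] linear_sum[OF lin(2)] inv_scaleC)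
  also have "\<dots> = v ^ Suc (Suc n) *\<^sub>C G v x
      + ((\<Sum>m<n. v ^ Suc m *\<^sub>C (inv T ^^ (Suc n - m)) x) + v ^ Suc n *\<^sub>C inv T x)"
    unfolding G by (simp add: scaleC_add_right scaleC_scaleC Suc_diff_le mult_ac add_ac)
  finally show ?case by simp
qed

text \<open>Once n < 2^k, the corrections of \<open>funpow_G\<close> average to 0. What remains has
  the factor \<open>inverse w ^ n\<close> with \<open>cmod w = b\<close>, and the bound survives the
  limit.\<close>

lemma mean_stable: "norm ((T ^^ n) (mean b x)) \<le> M * inverse b ^ n * norm x"
proof -
  have b: "b \<in> {a..b}" using ab by auto
  have avg: "(T ^^ n) (circle_avg k (\<lambda>u. G (of_real b * u) x))
      = circle_avg k (\<lambda>u. inverse (of_real b * u) ^ n *\<^sub>C G (of_real b * u) x)"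
    if n: "n < 2 ^ k" for k
  proof -
    have "(T ^^ n) (circle_avg k (\<lambda>u. G (of_real b * u) x))
        = circle_avg k (\<lambda>u. inverse (of_real b * u) ^ n *\<^sub>C G (of_real b * u) x
          - (\<Sum>m<n. inverse (of_real b) ^ (n - m) *\<^sub>C inverse u ^ (n - m) *\<^sub>C (T ^^ m) x))"
      unfolding circle_avg_linear[OF lin(3)]
      by (rule circle_avg_cong)
        (simp add: funpow_G[OF A_of_real[OF b]] scaleC_scaleC power_mult_distrib)
    also have "\<dots> = circle_avg k (\<lambda>u. inverse (of_real b * u) ^ n *\<^sub>C G (of_real b * u) x)
        - (\<Sum>m<n. inverse (of_real b) ^ (n - m) *\<^sub>C circle_avg k (\<lambda>u. inverse u ^ (n - m) *\<^sub>C (T ^^ m) x))"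
      by (simp add: circle_avg_diff circle_avg_sum circle_avg_linear[OF lin_scaleC])
    also have "(\<Sum>m<n. inverse (of_real b) ^ (n - m) *\<^sub>C circle_avg k (\<lambda>u. inverse u ^ (n - m) *\<^sub>C (T ^^ m) x)) = 0"
      by (rule sum.neutral) (use n in \<open>auto simp: circle_avg_inverse_power\<close>)
    finally show ?thesis by simp
  qed
  have bound: "norm ((T ^^ n) (circle_avg k (\<lambda>u. G (of_real b * u) x))) \<le> M * inverse b ^ n * norm x"
    if n: "n < 2 ^ k" for k
    unfolding avg[OF n]
  proof (rule circle_avg_norm)
    fix u assume u: "cmod u = 1"
    have "norm (inverse (of_real b * u) ^ n *\<^sub>C G (of_real b * u) x)
        = inverse b ^ n * norm (G (of_real b * u) x)"
      using u ab by (simp add: norm_scaleC norm_power norm_inverse norm_mult)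
    also have "\<dots> \<le> inverse b ^ n * (M * norm x)"
      using ab by (intro mult_left_mono G_AD(3)[OF A_of_real[OF b u]]) auto
    finally show "norm (inverse (of_real b * u) ^ n *\<^sub>C G (of_real b * u) x) \<le> M * inverse b ^ n * norm x"
      by (simp add: mult_ac)
  qed
  have "(\<lambda>k. norm ((T ^^ n) (circle_avg k (\<lambda>u. G (of_real b * u) x)))) \<longlonglongrightarrow> norm ((T ^^ n) (mean b x))"
    by (intro tendsto_norm bounded_linear.tendsto[OF bounded_linear_funpow[OF bl]] mean_LIMSEQ b)
  then show ?thesis
  proof (rule LIMSEQ_le_const2)
    have "n < 2 ^ k" if "k \<ge> n" for k
      using that less_exp[of k] by linarith
    then show "\<exists>N. \<forall>k\<ge>N. norm ((T ^^ n) (circle_avg k (\<lambda>u. G (of_real b * u) x))) \<le> M * inverse b ^ n * norm x"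
      using bound by blast
  qed
qed

text \<open>The same on the inner circle with \<open>inv_funpow_G\<close>: the remaining factor is
  \<open>w ^ Suc n\<close> with \<open>cmod w = a\<close>.\<close>

lemma mean_unstable: "norm ((inv T ^^ Suc n) (x - mean a x)) \<le> M * a ^ Suc n * norm x"
proof -
  have a: "a \<in> {a..b}" using ab by auto
  have avg: "(inv T ^^ Suc n) (circle_avg k (\<lambda>u. G (of_real a * u) x) - x)
      = circle_avg k (\<lambda>u. (of_real a * u) ^ Suc n *\<^sub>C G (of_real a * u) x)"
    if n: "n < 2 ^ k" for k
  proof -
    have "(inv T ^^ Suc n) (circle_avg k (\<lambda>u. G (of_real a * u) x) - x)
        = circle_avg k (\<lambda>u. (inv T ^^ Suc n) (G (of_real a * u) x - x))"
      unfolding circle_avg_linear[OF lin(4), symmetric] by (simp add: circle_avg_diff)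
    also have "\<dots> = circle_avg k (\<lambda>u. (of_real a * u) ^ Suc n *\<^sub>C G (of_real a * u) x
          + (\<Sum>m<n. of_real a ^ Suc m *\<^sub>C u ^ Suc m *\<^sub>C (inv T ^^ (n - m)) x))"
      by (rule circle_avg_cong)
        (simp only: inv_funpow_G[OF A_of_real[OF a]] scaleC_scaleC power_mult_distrib)
    also have "\<dots> = circle_avg k (\<lambda>u. (of_real a * u) ^ Suc n *\<^sub>C G (of_real a * u) x)
        + (\<Sum>m<n. of_real a ^ Suc m *\<^sub>C circle_avg k (\<lambda>u. u ^ Suc m *\<^sub>C (inv T ^^ (n - m)) x))"
      by (simp only: circle_avg_add circle_avg_sum circle_avg_linear[OF lin_scaleC])
    also have "(\<Sum>m<n. of_real a ^ Suc m *\<^sub>C circle_avg k (\<lambda>u. u ^ Suc m *\<^sub>C (inv T ^^ (n - m)) x)) = 0"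
      using n by (intro sum.neutral ballI) (simp add: circle_avg_power del: power_Suc)
    finally show ?thesis by simp
  qed
  have bound: "norm ((inv T ^^ Suc n) (circle_avg k (\<lambda>u. G (of_real a * u) x) - x)) \<le> M * a ^ Suc n * norm x"
    if n: "n < 2 ^ k" for k
    unfolding avg[OF n]
  proof (rule circle_avg_norm)
    fix u assume u: "cmod u = 1"
    have "norm ((of_real a * u) ^ Suc n *\<^sub>C G (of_real a * u) x)
        = a ^ Suc n * norm (G (of_real a * u) x)"
      using u ab by (simp add: norm_scaleC norm_power norm_mult)
    also have "\<dots> \<le> a ^ Suc n * (M * norm x)"
      using ab by (intro mult_left_mono G_AD(3)[OF A_of_real[OF a u]]) auto
    finally show "norm ((of_real a * u) ^ Suc n *\<^sub>C G (of_real a * u) x) \<le> M * a ^ Suc n * norm x"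
      by (simp only: mult_ac)
  qed
  have "(\<lambda>k. norm ((inv T ^^ Suc n) (circle_avg k (\<lambda>u. G (of_real a * u) x) - x)))
      \<longlonglongrightarrow> norm ((inv T ^^ Suc n) (mean a x - x))"
    by (intro tendsto_norm bounded_linear.tendsto[OF bounded_linear_funpow]
        bounded_linear_inv bl bij tendsto_diff tendsto_const mean_LIMSEQ a)
  then have "norm ((inv T ^^ Suc n) (mean a x - x)) \<le> M * a ^ Suc n * norm x"
  proof (rule LIMSEQ_le_const2)
    have "n < 2 ^ k" if "k \<ge> n" for k
      using that less_exp[of k] by linarith
    then show "\<exists>N. \<forall>k\<ge>N. norm ((inv T ^^ Suc n) (circle_avg k (\<lambda>u. G (of_real a * u) x) - x)) \<le> M * a ^ Suc n * norm x"
      using bound by blast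
  qed
  moreover have "(inv T ^^ Suc n) (mean a x - x) = - (inv T ^^ Suc n) (x - mean a x)"
    by (metis linear_neg[OF lin(4)] minus_diff_eq)
  ultimately show ?thesis by (simp only: norm_minus_cancel)
qed

lemma mean_T:
  assumes r: "r \<in> {a..b}"
  shows "mean r (T x) = T (mean r x)"
proof (rule LIMSEQ_unique[OF mean_LIMSEQ[OF r]])
  have "circle_avg k (\<lambda>u. G (of_real r * u) (T x)) = T (circle_avg k (\<lambda>u. G (of_real r * u) x))" for k
    unfolding circle_avg_linear[OF lin(1)] by (rule circle_avg_cong) (simp add: G_T A_of_real[OF r])
  then show "(\<lambda>k. circle_avg k (\<lambda>u. G (of_real r * u) (T x))) \<longlonglongrightarrow> T (mean r x)"
    using bounded_linear.tendsto[OF bl mean_LIMSEQ[OF r]] by simp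
qed

lemma exponential_dichotomy: "exponential_dichotomy T"
proof -
  have r: "a \<in> {a..b}" "b \<in> {a..b}" using ab by auto
  \<comment> \<open>The projection is used as \<open>mean b\<close> for forward powers and, since
    the radius does not matter, as \<open>mean a\<close> for inverse powers. \<beta> majorises both
    rates, and \<open>1 + M\<close> covers the inverse estimate at n = 0.\<close>
  define \<beta> where "\<beta> = max a (inverse b)"
  have \<beta>: "0 < \<beta>" "\<beta> < 1" using ab by (auto simp: \<beta>_def inverse_less_1_iff less_max_iff_disj)
  have le: "M * c ^ n * norm x \<le> (1 + M) * \<beta> ^ n * norm x" if "0 \<le> c" "c \<le> \<beta>" for c n and x :: 'b
    using that M \<beta> by (intro mult_right_mono mult_mono power_mono) auto
  show ?thesis
    unfolding exponential_dichotomy_def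
  proof (rule exI[of _ "mean b"], rule exI[of _ "1 + M"], rule exI[of _ \<beta>], intro conjI allI)
    show "0 < 1 + M" using M by simp
    show "mean b (T x) = T (mean b x)" for x by (rule mean_T[OF r(2)])
    fix x n
    show "norm ((T ^^ n) (mean b x)) \<le> (1 + M) * \<beta> ^ n * norm x"
      using ab by (intro order_trans[OF mean_stable le]) (auto simp: \<beta>_def)
    show "norm ((inv T ^^ n) (x - mean b x)) \<le> (1 + M) * \<beta> ^ n * norm x"
    proof (cases n)
      case 0
      then show ?thesis
        using norm_triangle_ineq4[of x "mean b x"] mean_stable[of 0 x] by (simp add: distrib_right)
    next
      case (Suc m)
      then show ?thesis
        unfolding Suc mean_indep[OF r(2,1)]
        using ab by (intro order_trans[OF mean_unstable le]) (auto simp: \<beta>_def)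
    qed
  qed (rule \<beta>)+
qed

end

section \<open>From hyperbolicity to a dichotomy\<close>

text \<open>For \<open>w\<close> on the circle, \<open>1 - w S\<close> is a multiple of
  \<open>S - 1 / w\<close>, hence bijective. Its lower bounds at single points become uniform by
  compactness and spread to an annulus by perturbation, where the Riesz projection is
  available.\<close>

lemma complex_hyperbolic_imp_dichotomy:
  fixes S :: "'b::complex_banach \<Rightarrow> 'b"
  assumes S: "bounded_clinear S" "bij S" and hyp: "complex_hyperbolic S"
  shows "exponential_dichotomy S"
proof -
  have bl: "bounded_linear S" using S(1) by (simp add: bounded_clinear_def)
  have lin: "linear S" using bl by (rule bounded_linear.linear)
  obtain K where K: "K > 0" "\<And>x. norm (S x) \<le> K * norm x"
    using bounded_linear.pos_bounded[OF bl] by (metis mult.commute)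
  define R where "R w x = x - w *\<^sub>C S x" for w x
  have blR: "bounded_linear (R w)" for w
    unfolding R_def
    by (intro bounded_linear_sub bounded_linear_ident
        bounded_linear_compose[OF bounded_linear_scaleC bl])
  have bijR: "bij (R w)" if w: "cmod w = 1" for w
  proof -
    have w0: "w \<noteq> 0" using w by auto
    have "cmod (inverse w) = 1" using w by (simp add: norm_inverse)
    then have 1: "bij (\<lambda>x. S x - inverse w *\<^sub>C x)"
      using hyp by (auto simp: complex_hyperbolic_def spectrum_def)
    have 2: "bij (\<lambda>x::'b. (- w) *\<^sub>C x)"
      by (rule o_bij[of "\<lambda>x. (- inverse w) *\<^sub>C x"]) (use w0 in \<open>auto simp: fun_eq_iff scaleC_scaleC\<close>)
    have "R w = (\<lambda>x. (- w) *\<^sub>C x) \<circ> (\<lambda>x. S x - inverse w *\<^sub>C x)"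
      using w0 by (auto simp: R_def fun_eq_iff scaleC_diff_right scaleC_scaleC scaleC_minus_left)
    then show ?thesis using bij_comp[OF 1 2] by simp
  qed
  have pert: "R w x = R z x - (w - z) *\<^sub>C S x" for w z x
    by (simp add: R_def scaleC_diff_left)
  have npert: "norm ((w - z) *\<^sub>C S x) \<le> cmod (w - z) * K * norm x" for w z x
    using mult_left_mono[OF K(2)[of x], of "cmod (w - z)"] by (simp add: norm_scaleC mult_ac)
  have "\<forall>w\<in>sphere 0 1. \<exists>c>0. \<forall>x. c * norm x \<le> norm (R w x)"
    using bij_bounded_linear_bounded_below[OF blR bijR] by (metis mem_sphere_0)
  then obtain c where c: "\<And>w. cmod w = 1 \<Longrightarrow> c w > 0"
    "\<And>w x. cmod w = 1 \<Longrightarrow> c w * norm x \<le> norm (R w x)"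
    by (metis mem_sphere_0)
  \<comment> \<open>Within this radius of \<open>z\<close> the perturbation \<open>(w - z) S\<close>
    has norm at most \<open>c z / 2\<close>, as \<open>bij_bounded_below_perturb\<close>
    requires.\<close>
  obtain F where F: "F \<subseteq> sphere 0 1" "finite F" "sphere 0 1 \<subseteq> (\<Union>z\<in>F. ball z (c z / (2 * K)))"
  proof (rule compactE_image[of "sphere (0::complex) 1" "sphere 0 1" "\<lambda>z. ball z (c z / (2 * K))"])
    show "sphere 0 1 \<subseteq> (\<Union>z\<in>sphere 0 1. ball z (c z / (2 * K)))"
      using c(1) K(1) by fastforce
  qed auto
  have Fne: "F \<noteq> {}" using F(3) by (auto intro: exI[of _ 1])
  \<comment> \<open>The half is what the perturbation loses.\<close>
  define c0 where "c0 = Min (c ` F) / 2"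
  have c0: "c0 > 0" using F(1,2) Fne c(1) by (auto simp: c0_def)
  have circ: "c0 * norm x \<le> norm (R w x)" if w: "cmod w = 1" for w x
  proof -
    obtain z where z: "z \<in> F" "dist z w < c z / (2 * K)" using F(3) w by auto
    have z1: "cmod z = 1" using z(1) F(1) by auto
    have "c0 \<le> c z / 2" using F(2) z(1) by (simp add: c0_def)
    then have "c0 * norm x \<le> c z / 2 * norm x" by (intro mult_right_mono) auto
    also have "\<dots> \<le> norm (R w x)"
      unfolding pert[of w x z]
    proof (rule bij_bounded_below_perturb(1))
      show "linear (R z)" "bij (R z)"
        using blR bounded_linear.linear bijR z1 by blast+
      show "linear (\<lambda>x. (w - z) *\<^sub>C S x)"
        using bounded_linear_compose[OF bounded_linear_scaleC bl] bounded_linear.linear by blast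
      show "norm ((w - z) *\<^sub>C S x) \<le> c z / 2 * norm x" for x
      proof (rule order_trans[OF npert mult_right_mono])
        show "cmod (w - z) * K \<le> c z / 2"
          using z(2) K(1) by (simp add: dist_norm norm_minus_commute field_simps)
      qed simp
    qed (use c z1 in auto)
    finally show ?thesis .
  qed
  \<comment> \<open>The bound 1/2 keeps the annulus away from 0; the other one keeps the
    perturbation from circle to annulus at most \<open>c0 / 2\<close>.\<close>
  define d where "d = min (1 / 2) (c0 / (2 * K))"
  have d: "0 < d" "d < 1" "d * K \<le> c0 / 2"
    using c0 K(1) by (auto simp: d_def min_def field_simps)
  have annulus: "bij (R w)" "c0 / 2 * norm x \<le> norm (R w x)"
    if w: "1 - d \<le> cmod w" "cmod w \<le> 1 + d" for w x
  proof -
    \<comment> \<open>The point of the unit circle nearest to \<open>w\<close>, at distance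
      \<open>\<bar>cmod w - 1\<bar>\<close>.\<close>
    define z where "z = sgn w"
    have w0: "w \<noteq> 0" using w d by auto
    have z1: "cmod z = 1" using w0 by (simp add: z_def norm_sgn)
    have "w - z = (of_real (cmod w) - 1) * z"
      using w0 by (simp add: z_def sgn_eq field_simps)
    then have "cmod (w - z) = \<bar>cmod w - 1\<bar>"
      using z1 by (simp add: norm_mult) (metis norm_of_real of_real_1 of_real_diff)
    then have wz: "cmod (w - z) * K \<le> c0 / 2"
      using d(3) K(1) w mult_right_mono[of "cmod (w - z)" d K] by linarith
    have *: "linear (R z)" "bij (R z)"
      using blR bounded_linear.linear bijR z1 by blast+
    have lin2: "linear (\<lambda>x. (w - z) *\<^sub>C S x)"
      using bounded_linear_compose[OF bounded_linear_scaleC bl] bounded_linear.linear by blast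
    have le: "norm ((w - z) *\<^sub>C S x) \<le> c0 / 2 * norm x" for x
      by (rule order_trans[OF npert mult_right_mono[OF wz]]) simp
    have R: "R w = (\<lambda>x. R z x - (w - z) *\<^sub>C S x)" using pert by blast
    show "bij (R w)" "c0 / 2 * norm x \<le> norm (R w x)"
      unfolding R using bij_bounded_below_perturb[OF * c0 circ[OF z1] lin2 le] by auto
  qed
  interpret annular_resolvent S "\<lambda>w. inv (R w)" K "2 / c0" "1 - d" "1 + d"
  proof
    fix w x assume w: "1 - d \<le> cmod w" "cmod w \<le> 1 + d"
    have 1: "R w (inv (R w) y) = y" "inv (R w) (R w y) = y" for y
      using annulus(1)[OF w] by (simp_all add: bij_is_inj bij_is_surj surj_f_inv_f)
    show "inv (R w) x - w *\<^sub>C S (inv (R w) x) = x" "inv (R w) (x - w *\<^sub>C S x) = x"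
      using 1[of x] by (simp_all add: R_def)
    show "norm (inv (R w) x) \<le> 2 / c0 * norm x"
      using annulus(2)[OF w, of "inv (R w) x"] 1(1)[of x] c0 by (simp add: field_simps)
  qed (use S K d c0 in auto)
  show ?thesis by (rule exponential_dichotomy)
qed

text \<open>The map is the real part of the complex \<open>P\<close> on vectors
  \<open>Cplx x 0\<close>. Taking real parts commutes with the complexified powers, and neither the
  embedding nor the real part increases the norm, so the constants stay the same.\<close>

lemma real_hyperbolic_imp_dichotomy:
  fixes T :: "'a::banach \<Rightarrow> 'a"
  assumes T: "bounded_linear T" "bij T" and hyp: "real_hyperbolic T"
  shows "exponential_dichotomy T"
proof -
  have "exponential_dichotomy (complexify T)"
    using hyp by (intro complex_hyperbolic_imp_dichotomy bounded_clinear_complexify bij_complexify T)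
      (simp add: real_hyperbolic_def complex_hyperbolic_def)
  then obtain P M \<beta> where P: "0 < M" "0 < \<beta>" "\<beta> < 1" "\<And>z. P (complexify T z) = complexify T (P z)"
    "\<And>z n. norm ((complexify T ^^ n) (P z)) \<le> M * \<beta> ^ n * norm z"
    "\<And>z n. norm ((inv (complexify T) ^^ n) (z - P z)) \<le> M * \<beta> ^ n * norm z"
    unfolding exponential_dichotomy_def by blast
  have T0: "T 0 = 0" using T(1) by (simp add: bounded_linear.linear linear_0)
  have norm_real: "norm (Cplx x 0) \<le> norm (x::'a)" for x
    using norm_complexification_le_sum[of "Cplx x 0"] by simp
  have le: "M * \<beta> ^ n * norm (Cplx x 0) \<le> M * \<beta> ^ n * norm x" for n and x :: 'a
    using P(1,2) by (intro mult_left_mono norm_real) auto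
  show ?thesis
    unfolding exponential_dichotomy_def
  proof (rule exI[of _ "\<lambda>x. re_part (P (Cplx x 0))"], rule exI[of _ M], rule exI[of _ \<beta>],
      intro conjI allI P(1-3))
    show "re_part (P (Cplx (T x) 0)) = T (re_part (P (Cplx x 0)))" for x
      using P(4)[of "Cplx x 0"] by (simp add: complexify_def T0)
    fix x n
    have "(T ^^ n) (re_part (P (Cplx x 0))) = re_part ((complexify T ^^ n) (P (Cplx x 0)))"
      by (simp add: complexify_funpow complexify_def)
    then show "norm ((T ^^ n) (re_part (P (Cplx x 0)))) \<le> M * \<beta> ^ n * norm x"
      using norm_re_part_le order_trans[OF P(5) le] by (metis order_trans)
    have "(inv T ^^ n) (x - re_part (P (Cplx x 0)))
        = re_part ((inv (complexify T) ^^ n) (Cplx x 0 - P (Cplx x 0)))"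
      by (simp add: inv_complexify_funpow[OF T(2)] complexify_def minus_complexification_def)
    then show "norm ((inv T ^^ n) (x - re_part (P (Cplx x 0)))) \<le> M * \<beta> ^ n * norm x"
      using norm_re_part_le order_trans[OF P(6) le] by (metis order_trans)
  qed
qed

section \<open>The equivalences, by way of the dichotomy\<close>

lemma exponential_dichotomy_imp:
  fixes T :: "'a::banach \<Rightarrow> 'a"
  assumes "bounded_linear T" "bij T" "exponential_dichotomy T"
  shows "hyperbolic_coordinates T" "expansive T" "shadowing_property T"
proof -
  obtain P M \<beta> where "dichotomy T P M \<beta>"
    using exponential_dichotomy_locale[OF assms] .
  then show "hyperbolic_coordinates T" "expansive T" "shadowing_property T"
    by (rule dichotomy.imp_hyperbolic_coordinates dichotomy.imp_expansive dichotomy.imp_shadowing)+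
qed

theorem theorem1:
  fixes T :: "'a::banach \<Rightarrow> 'a" and S :: "'b::complex_banach \<Rightarrow> 'b"
  shows "(bounded_linear T \<and> bij T \<longrightarrow>
            (real_hyperbolic T \<longleftrightarrow> hyperbolic_coordinates T) \<and>
            (hyperbolic_coordinates T \<longleftrightarrow> expansive T \<and> shadowing_property T)) \<and>
         (bounded_clinear S \<and> bij S \<longrightarrow>
            (complex_hyperbolic S \<longleftrightarrow> hyperbolic_coordinates S) \<and>
            (hyperbolic_coordinates S \<longleftrightarrow> expansive S \<and> shadowing_property S))"
proof (intro conjI impI; elim conjE)
  assume T: "bounded_linear T" "bij T"
  show "real_hyperbolic T \<longleftrightarrow> hyperbolic_coordinates T"
    "hyperbolic_coordinates T \<longleftrightarrow> expansive T \<and> shadowing_property T"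
    using exponential_dichotomy_imp[OF T] hyperbolic_coordinates_imp_dichotomy[OF T]
      expansive_shadowing_imp_real_hyperbolic[OF T] real_hyperbolic_imp_dichotomy[OF T] by blast+
next
  assume S: "bounded_clinear S" "bij S"
  then have bl: "bounded_linear S" by (simp add: bounded_clinear_def)
  show "complex_hyperbolic S \<longleftrightarrow> hyperbolic_coordinates S"
    "hyperbolic_coordinates S \<longleftrightarrow> expansive S \<and> shadowing_property S"
    using exponential_dichotomy_imp[OF bl S(2)] hyperbolic_coordinates_imp_dichotomy[OF bl S(2)]
      expansive_shadowing_imp_complex_hyperbolic[OF S] complex_hyperbolic_imp_dichotomy[OF S] by blast+
qed

end
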